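(* Let $X=C[0,1]$ and let $\varepsilon\in(0,1)$, $(P_n)$, $(a_n)$, $(Y_n)$, $(X_n)$ and $B_n^\delta$ be as described in the context. There exists a sequence $(\delta_n)$ of positive real numbers with $\delta_n\to0$ such that for every sequence $(\lambda_n)$ of positive real numbers, the subset of $C[0,1]$ given by $$K=\overline{\mathrm{co}}\left(\bigcup_{n\in\mathbb{N}}\lambda_nB_n^{\delta_n}\right)$$ is not a Lipschitz retract of $C[0,1]$.
   Context: Real scalars. A sequence of finite dimensional subspaces $(Z_n)$ of a Banach space $X$ is an FDD if every $x\in X$ has a unique expansion $x=\sum_n x_n$ (norm convergent) with $x_n\in Z_n$; its natural projections are $P_n(x)=\sum_{i=1}^nx_i$, $P_0=0$. Setting: fix $\varepsilon\in(0,1)$, an FDD of $X=C[0,1]$ with natural projections $(P_n)$ and a sequence $(a_n)\subset X$ which is $(1+\varepsilon)$-equivalent to the canonical basis of $\ell_2$, such that $\sup_n d(P_n(X),\ell_\infty^{d(n)})<\infty$, where $d(n)=\dim P_n(X)$ and $d(\cdot,\cdot)$ is the Banach–Mazur distance, and $a_n\in(P_n-P_{n-1})(X)$ for every $n$. (Such objects exist for every $\varepsilon\in(0,1)$.) Define $\sigma(0)=0$, $\sigma(1)=1$ and $\sigma(n)=\sigma(n-1)+n$ for $n\ge2$; $Q_0=0$, $Q_n=P_{\sigma(n)}$; $X_n=(Q_n-Q_{n-1})(X)$; and $Y_n=\mathrm{span}\{a_{\sigma(n-1)+1},\dots,a_{\sigma(n)}\}\subset X_n$, which is $(1+\varepsilon)$-isometric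 to $\ell_2^n$. For $\delta>0$ put $$B_n^\delta=\{x\in X_n: d(x,B_{Y_n})\le\delta\},$$ where $B_{Y_n}$ is the closed unit ball of $Y_n$ and $d(x,B_{Y_n})$ the norm distance. $\overline{\mathrm{co}}$ denotes closed convex hull. $K\subset X$ is a Lipschitz retract of $X$ if there is a Lipschitz map $R:X\to K$ with $R|_K=\mathrm{Id}_K$. *)

theory Defs
  imports "HOL-Analysis.Analysis"
begin

text \<open>
  \<open>C[0,1]\<close> is the type of bounded continuous real functions on a type copy of the interval
  \<open>{0..1}\<close>; boundedness is automatic by compactness (lemma \<open>continuous_imp_bcontfun\<close>).
\<close>

typedef unit_interval = "{0..1::real}"
  morphisms real_of_ui ui_of_real
  by (rule exI[of _ 0]) simp

instantiation unit_interval :: metric_space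
begin

definition dist_unit_interval :: "unit_interval \<Rightarrow> unit_interval \<Rightarrow> real"
  where "dist_unit_interval x y = dist (real_of_ui x) (real_of_ui y)"

definition uniformity_unit_interval :: "(unit_interval \<times> unit_interval) filter"
  where "uniformity_unit_interval = (INF e\<in>{0<..}. principal {(x, y). dist x y < e})"

definition open_unit_interval :: "unit_interval set \<Rightarrow> bool"
  where "open_unit_interval U \<longleftrightarrow>
    (\<forall>x\<in>U. \<forall>\<^sub>F (x', y) in uniformity. x' = x \<longrightarrow> y \<in> U)"

instance
proof
  fix x y z :: unit_interval
  show "dist x y = 0 \<longleftrightarrow> x = y"
    by (simp add: dist_unit_interval_def real_of_ui_inject)
  show "dist x y \<le> dist x z + dist y z"
    unfolding dist_unit_interval_def by (rule dist_triangle2)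
qed (simp_all add: uniformity_unit_interval_def open_unit_interval_def)

end

lemma continuous_on_ui_of_real: "continuous_on {0..1} ui_of_real"
  by (auto simp: continuous_on_iff dist_unit_interval_def ui_of_real_inverse)

lemma compact_UNIV_unit_interval: "compact (UNIV :: unit_interval set)"
proof -
  have "ui_of_real ` {0..1} = UNIV"
    by (metis type_definition.Abs_image type_definition_unit_interval)
  then show ?thesis
    by (metis compact_Icc compact_continuous_image continuous_on_ui_of_real)
qed

lemma continuous_imp_bcontfun:
  fixes f :: "unit_interval \<Rightarrow> real"
  assumes "continuous_on UNIV f"
  shows "f \<in> bcontfun"
  using assms compact_UNIV_unit_interval
  by (auto simp: bcontfun_def intro!: compact_imp_bounded compact_continuous_image)

type_synonym C01 = "unit_interval \<Rightarrow>\<^sub>C real"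

text \<open>
  All sequences are indexed by \<open>n \<ge> 1\<close>; an expansion \<open>u\<close> is given the dummy value \<open>u 0 = 0\<close>,
  so that \<open>u sums x\<close> is the sum over \<open>n \<ge> 1\<close> and uniqueness makes sense.
\<close>

definition fdd_expansion :: "(nat \<Rightarrow> 'a::real_normed_vector set) \<Rightarrow> 'a \<Rightarrow> (nat \<Rightarrow> 'a) \<Rightarrow> bool"
  where "fdd_expansion Z x u \<longleftrightarrow> u 0 = 0 \<and> (\<forall>n\<ge>1. u n \<in> Z n) \<and> u sums x"

definition is_FDD :: "(nat \<Rightarrow> 'a::real_normed_vector set) \<Rightarrow> bool"
  where "is_FDD Z \<longleftrightarrow>
    (\<forall>n\<ge>1. \<exists>B. finite B \<and> Z n = span B) \<and> (\<forall>x. \<exists>!u. fdd_expansion Z x u)"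

definition fdd_proj :: "(nat \<Rightarrow> 'a::real_normed_vector set) \<Rightarrow> nat \<Rightarrow> 'a \<Rightarrow> 'a"
  where "fdd_proj Z n x = (\<Sum>i=1..n. (THE u. fdd_expansion Z x u) i)"

definition linear_iso_on ::
    "'a::real_vector set \<Rightarrow> 'b::real_vector set \<Rightarrow> ('a \<Rightarrow> 'b) \<Rightarrow> bool"
  where "linear_iso_on V W T \<longleftrightarrow> bij_betw T V W \<and>
    (\<forall>x\<in>V. \<forall>y\<in>V. T (x + y) = T x + T y) \<and> (\<forall>c. \<forall>x\<in>V. T (c *\<^sub>R x) = c *\<^sub>R T x)"

definition opnorm_on ::
    "'a::real_normed_vector set \<Rightarrow> ('a \<Rightarrow> 'b::real_normed_vector) \<Rightarrow> ennreal"
  where "opnorm_on V T = (SUP x\<in>V \<inter> cball 0 1. ennreal (norm (T x)))"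

text \<open>
  The Banach-Mazur distance of two linear subspaces, \<open>\<infinity>\<close> if they are not isomorphic.
  Unbounded \<open>T\<close> or \<open>T\<^sup>-\<^sup>1\<close> contribute \<open>\<infinity>\<close>: a factor is \<open>0\<close> only if both spaces are trivial.
\<close>

definition banach_mazur_dist ::
    "'a::real_normed_vector set \<Rightarrow> 'b::real_normed_vector set \<Rightarrow> ennreal"
  where "banach_mazur_dist V W =
    (INF T\<in>{T. linear_iso_on V W T}. opnorm_on V T * opnorm_on W (inv_into V T))"

text \<open>\<open>\<ell>\<^sub>\<infinity>\<^sup>d\<close>, as a subspace of the bounded sequences with the supremum norm.\<close>

definition linf :: "nat \<Rightarrow> (nat \<Rightarrow>\<^sub>C real) set"
  where "linf d = {f. \<forall>i\<ge>d. apply_bcontfun f i = 0}"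

text \<open>
  \<open>C\<close>-equivalence means that \<open>a\<^sub>n \<mapsto> e\<^sub>n\<close> extends to an isomorphism \<open>T\<close> of the
  closed spans with \<open>\<parallel>T\<parallel> \<parallel>T\<^sup>-\<^sup>1\<parallel> \<le> C\<close>; \<open>L2_set t {1..N}\<close> is the norm of
  \<open>t\<^sub>1 e\<^sub>1 + \<dots> + t\<^sub>N e\<^sub>N\<close> in \<open>\<ell>\<^sub>2\<close>.
\<close>

definition equiv_l2_basis :: "real \<Rightarrow> (nat \<Rightarrow> 'a::real_normed_vector) \<Rightarrow> bool"
  where "equiv_l2_basis C a \<longleftrightarrow> (\<exists>A>0. \<exists>B>0. A * B \<le> C \<and>
    (\<forall>N t. L2_set t {1..N} / A \<le> norm (\<Sum>i=1..N. t i *\<^sub>R a i) \<and>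
           norm (\<Sum>i=1..N. t i *\<^sub>R a i) \<le> B * L2_set t {1..N}))"

fun sigma :: "nat \<Rightarrow> nat"
  where
    "sigma 0 = 0"
  | "sigma (Suc n) = sigma n + Suc n"

definition Q_proj :: "(nat \<Rightarrow> 'a \<Rightarrow> 'a) \<Rightarrow> nat \<Rightarrow> 'a \<Rightarrow> 'a::real_normed_vector"
  where "Q_proj P n = P (sigma n)"

definition X_block :: "(nat \<Rightarrow> 'a \<Rightarrow> 'a) \<Rightarrow> nat \<Rightarrow> 'a::real_normed_vector set"
  where "X_block P n = range (\<lambda>x. Q_proj P n x - Q_proj P (n - 1) x)"

definition Y_block :: "(nat \<Rightarrow> 'a) \<Rightarrow> nat \<Rightarrow> 'a::real_normed_vector set"
  where "Y_block a n = span (a ` {sigma (n - 1) + 1..sigma n})"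

definition B_nbhd ::
    "(nat \<Rightarrow> 'a \<Rightarrow> 'a) \<Rightarrow> (nat \<Rightarrow> 'a) \<Rightarrow> nat \<Rightarrow> real \<Rightarrow> 'a::real_normed_vector set"
  where "B_nbhd P a n \<delta> = {x \<in> X_block P n. infdist x (Y_block a n \<inter> cball 0 1) \<le> \<delta>}"

definition lipschitz_retract :: "'a::metric_space set \<Rightarrow> bool"
  where "lipschitz_retract K \<longleftrightarrow>
    (\<exists>R L. L-lipschitz_on UNIV R \<and> range R \<subseteq> K \<and> (\<forall>x\<in>K. R x = x))"

end

theory Submission
  imports Defs
begin

text \<open>
  A Lipschitz retraction \<open>R\<close> onto \<open>K\<close> yields, after composition with the uniformly bounded block
  projections \<open>Q\<^sub>n - Q\<^sub>n\<^sub>-\<^sub>1\<close> and rescaling by \<open>\<lambda>\<^sub>n\<close>, retractions of \<open>C[0,1]\<close> onto the sets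
  \<open>B\<^sub>n\<close> with Lipschitz constants bounded in \<open>n\<close>. On the other hand, if for a fixed \<open>n\<close> there were
  \<open>L\<close>-Lipschitz retractions onto the \<open>\<delta>\<close>-neighbourhoods of the ball of \<open>Y\<^sub>n\<close> for all small \<open>\<delta>\<close>, then
  blowing up and compactness would give an \<open>L\<close>-Lipschitz retraction onto \<open>Y\<^sub>n\<close>, and averaging over
  translations (Lindenstrauss) would turn it into a linear projection of norm at most \<open>L\<close>. As
  \<open>Y\<^sub>n\<close> is \<open>2\<close>-isomorphic to \<open>\<ell>\<^sub>2\<^sup>n\<close>, Khintchine's inequality shows that such a projection has norm
  greater than \<open>sqrt n / 8\<close>. Hence \<open>\<delta>\<^sub>n \<le> 1/n\<close> can be chosen such that there is no
  \<open>sqrt n / 8\<close>-Lipschitz retraction onto \<open>B\<^sub>n\<close>.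
\<close>

section \<open>Finite-dimensional subspaces and additive maps\<close>

lemma closed_if_closed_Int_cball:
  fixes S :: "'a::real_normed_vector set"
  assumes "\<And>r. closed (S \<inter> cball 0 r)"
  shows "closed S"
  unfolding closed_sequential_limits
proof (intro allI impI)
  fix s l assume s: "(\<forall>n. s n \<in> S) \<and> s \<longlonglongrightarrow> l"
  then have "bounded (range s)"
    by (meson convergent_imp_bounded)
  then obtain r where "\<And>n. norm (s n) \<le> r"
    by (auto simp: bounded_iff)
  with s have "\<forall>n. s n \<in> S \<inter> cball 0 r"
    by auto
  then show "l \<in> S"
    using s assms closed_sequentially by blast
qed

text \<open>Heine-Borel for finite-dimensional subspaces of any normed space, by induction on the
  spanning set. If b lies outside the closed subspace \<open>span B\<close>, its distance d to it
  controls the coefficient of b, so the new ball is a closed part of the image of a compact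
  product.\<close>

lemma compact_span_Int_cball:
  fixes B :: "'a::real_normed_vector set"
  assumes "finite B"
  shows "compact (span B \<inter> cball 0 r)"
  using assms
proof (induction B arbitrary: r rule: finite_induct)
  case empty
  show ?case
    by (rule finite_imp_compact) auto
next
  case (insert b B)
  have closed: "closed (span B)"
    by (rule closed_if_closed_Int_cball) (rule compact_imp_closed[OF insert.IH])
  show ?case
  proof (cases "b \<in> span B")
    case True
    then show ?thesis
      using insert.IH by (simp add: span_redundant)
  next
    case False
    define d where "d = infdist b (span B)"
    have d: "d > 0"
      using False closed infdist_pos_not_in_closed[of "span B" b] span_zero
      unfolding d_def by blast
    have bound: "\<bar>k\<bar> * d \<le> norm (x + k *\<^sub>R b)" if "x \<in> span B" for x k
    proof (cases "k = 0")
      case False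
      have "- (1 / k) *\<^sub>R x \<in> span B"
        using that span_scale by blast
      then have "d \<le> dist b (- (1 / k) *\<^sub>R x)"
        unfolding d_def by (rule infdist_le)
      also have "\<bar>k\<bar> * \<dots> = norm (k *\<^sub>R (b - (- (1 / k) *\<^sub>R x)))"
        by (simp add: dist_norm)
      also have "k *\<^sub>R (b - (- (1 / k) *\<^sub>R x)) = x + k *\<^sub>R b"
        using False by (simp add: algebra_simps)
      finally show ?thesis
        by (simp add: mult_left_mono)
    qed auto
    \<comment> \<open>\<open>R\<close> bounds the norm of \<open>y - k *\<^sub>R b\<close> once
      \<open>norm y \<le> r\<close> and
      \<open>\<bar>k\<bar> \<le> \<bar>r\<bar> / d\<close>.\<close>
    define R where "R = r + \<bar>r\<bar> / d * norm b"
    let ?f = "\<lambda>(x, k). x + k *\<^sub>R b"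
    let ?K = "?f ` ((span B \<inter> cball 0 R) \<times> {- (\<bar>r\<bar> / d)..\<bar>r\<bar> / d})"
    have "compact ?K"
      by (intro compact_continuous_image compact_Times insert.IH compact_Icc)
        (auto simp: case_prod_unfold intro!: continuous_intros)
    moreover have "span (insert b B) \<inter> cball 0 r = ?K \<inter> cball 0 r"
    proof (intro equalityI subsetI)
      fix y assume y: "y \<in> span (insert b B) \<inter> cball 0 r"
      then obtain k where k: "y - k *\<^sub>R b \<in> span B"
        by (auto simp: span_insert)
      have "\<bar>k\<bar> * d \<le> norm (y - k *\<^sub>R b + k *\<^sub>R b)"
        by (rule bound[OF k])
      then have "\<bar>k\<bar> * d \<le> \<bar>r\<bar>"
        using y by auto
      then have kd: "\<bar>k\<bar> \<le> \<bar>r\<bar> / d"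
        using d by (simp add: field_simps)
      have "norm (y - k *\<^sub>R b) \<le> norm y + \<bar>k\<bar> * norm b"
        by (metis norm_scaleR norm_triangle_ineq4)
      also have "\<dots> \<le> R"
        unfolding R_def using y kd by (intro add_mono mult_right_mono) auto
      finally have "(y - k *\<^sub>R b, k) \<in> (span B \<inter> cball 0 R) \<times> {- (\<bar>r\<bar> / d)..\<bar>r\<bar> / d}"
        using k kd by auto
      then have "?f (y - k *\<^sub>R b, k) \<in> ?K"
        by (rule imageI)
      with y show "y \<in> ?K \<inter> cball 0 r"
        by simp
    next
      fix y assume y: "y \<in> ?K \<inter> cball 0 r"
      then obtain x k where "x \<in> span B" "y = x + k *\<^sub>R b"
        by auto
      then have "y \<in> span (insert b B)"
        by (metis add_diff_cancel_right' span_breakdown_eq)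
      with y show "y \<in> span (insert b B) \<inter> cball 0 r"
        by blast
    qed
    ultimately show ?thesis
      by (simp add: compact_Int_closed)
  qed
qed

lemma closed_span_finite:
  fixes B :: "'a::real_normed_vector set"
  assumes "finite B"
  shows "closed (span B)"
  by (rule closed_if_closed_Int_cball)
    (rule compact_imp_closed[OF compact_span_Int_cball[OF assms]])

text \<open>Tychonoff's theorem for pointwise convergence. It supplies limits of Lipschitz maps with
  values in compact sets.\<close>

lemma compact_Pi_UNIV:
  fixes S :: "'a \<Rightarrow> 'b::topological_space set"
  assumes "\<And>x. compact (S x)"
  shows "compact {g. \<forall>x. g x \<in> S x}"
proof -
  have "compactin (product_topology (\<lambda>_. euclidean) UNIV) (PiE UNIV S)"
    using assms by (simp add: compactin_PiE)
  moreover have "PiE UNIV S = {g. \<forall>x. g x \<in> S x}"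
    by (auto simp: PiE_def)
  ultimately show ?thesis
    by (simp add: euclidean_product_topology)
qed

text \<open>On the line through x, the defect of homogeneity \<open>\<phi>\<close> is additive and
  vanishes at the integers, so it is 1-periodic and bounded. A nonzero value would have unbounded
  multiples, so \<open>\<phi>\<close> vanishes.\<close>

lemma additive_bounded_imp_linear:
  fixes h :: "'a::real_normed_vector \<Rightarrow> 'b::real_normed_vector"
  assumes add: "\<And>x y. h (x + y) = h x + h y"
    and bdd: "\<And>x. norm (h x) \<le> L * norm x"
  shows "linear h"
proof (rule linearI)
  fix c x
  define \<phi> where "\<phi> t = h (t *\<^sub>R x) - t *\<^sub>R h x" for t
  have h0: "h 0 = 0"
    using add[of 0 0] by simp
  have \<phi>_add: "\<phi> (s + t) = \<phi> s + \<phi> t" for s t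
    by (simp add: \<phi>_def add algebra_simps)
  have \<phi>0: "\<phi> 0 = 0" "\<phi> 1 = 0"
    by (simp_all add: \<phi>_def h0)
  have \<phi>_nat: "\<phi> (of_nat n * t) = of_nat n *\<^sub>R \<phi> t" for n t
    by (induction n) (simp_all add: \<phi>0 \<phi>_add algebra_simps)
  have \<phi>_int: "\<phi> (of_int k) = 0" for k
  proof -
    have nat: "\<phi> (of_nat n) = 0" for n
      using \<phi>_nat[of n 1] \<phi>0 by simp
    have "\<phi> (- real n) = 0" for n
      using \<phi>_add[of "- real n" "real n"] nat[of n] \<phi>0 by simp
    with nat show ?thesis
      by (cases k rule: int_cases2) auto
  qed
  define M where "M = L * norm x + norm (h x)"
  have "norm (\<phi> (frac t)) \<le> \<bar>frac t\<bar> * M" for t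
  proof -
    have "norm (\<phi> (frac t)) \<le> norm (h (frac t *\<^sub>R x)) + norm (frac t *\<^sub>R h x)"
      unfolding \<phi>_def by (rule norm_triangle_ineq4)
    also have "\<dots> \<le> L * norm (frac t *\<^sub>R x) + norm (frac t *\<^sub>R h x)"
      by (intro add_right_mono bdd)
    finally show ?thesis
      by (simp add: M_def algebra_simps)
  qed
  moreover have "M \<ge> 0"
    using bdd[of x] norm_ge_zero[of "h x"] unfolding M_def by linarith
  moreover have "\<bar>frac t\<bar> \<le> 1" for t :: real
    using frac_lt_1[of t] frac_ge_0[of t] by linarith
  ultimately have frac_bound: "norm (\<phi> (frac t)) \<le> M" for t
    by (meson mult_left_le_one_le order_trans abs_ge_zero)
  have \<phi>_bound: "norm (\<phi> t) \<le> M" for t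
    using \<phi>_add[of "frac t" "of_int \<lfloor>t\<rfloor>"] \<phi>_int frac_bound[of t] by (simp add: frac_def)
  have "\<phi> c = 0"
  proof (rule ccontr)
    assume "\<phi> c \<noteq> 0"
    then obtain n where "M < of_nat n * norm (\<phi> c)"
      using ex_less_of_nat_mult[of "norm (\<phi> c)" M] by auto
    also have "\<dots> = norm (\<phi> (of_nat n * c))"
      by (simp add: \<phi>_nat)
    finally show False
      using \<phi>_bound[of "of_nat n * c"] by linarith
  qed
  then show "h (c *\<^sub>R x) = c *\<^sub>R h x"
    by (simp add: \<phi>_def)
qed (rule add)

section \<open>The projection constant of Hilbertian subspaces\<close>

text \<open>A subset encodes a vector of signs: a sum over \<open>Pow I\<close> is
  \<open>2 ^ card I\<close> times an expectation over independent random signs.\<close>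

definition sgn_in :: "'a set \<Rightarrow> 'a \<Rightarrow> real"
  where "sgn_in S j = (if j \<in> S then 1 else - 1)"

text \<open>Conditioning on the sign of b: the sets with b give the plus term, those without b the
  minus term. This drives the induction for both moments.\<close>

lemma sum_Pow_insert_signs:
  fixes F :: "real \<Rightarrow> real"
  assumes "finite I" "b \<notin> I"
  shows "(\<Sum>S\<in>Pow (insert b I). F (\<Sum>j\<in>insert b I. sgn_in S j * v j)) =
    (\<Sum>S\<in>Pow I. F ((\<Sum>j\<in>I. sgn_in S j * v j) + v b) + F ((\<Sum>j\<in>I. sgn_in S j * v j) - v b))"
proof -
  let ?G = "\<lambda>S. F (\<Sum>j\<in>insert b I. sgn_in S j * v j)"
  have inj: "inj_on (insert b) (Pow I)"
    using assms(2) by (auto simp: inj_on_def)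
  have disj: "Pow I \<inter> insert b ` Pow I = {}"
    using assms(2) by auto
  have "sum ?G (Pow (insert b I)) = sum ?G (Pow I) + sum ?G (insert b ` Pow I)"
    unfolding Pow_insert using assms disj by (intro sum.union_disjoint) auto
  also have "sum ?G (insert b ` Pow I) = (\<Sum>S\<in>Pow I. ?G (insert b S))"
    by (simp add: sum.reindex[OF inj])
  also have "\<dots> = (\<Sum>S\<in>Pow I. F ((\<Sum>j\<in>I. sgn_in S j * v j) + v b))"
  proof (intro sum.cong refl)
    fix S
    have "(\<Sum>j\<in>I. sgn_in (insert b S) j * v j) = (\<Sum>j\<in>I. sgn_in S j * v j)"
      using assms(2) by (intro sum.cong) (auto simp: sgn_in_def)
    then show "?G (insert b S) = F ((\<Sum>j\<in>I. sgn_in S j * v j) + v b)"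
      using assms by (simp add: sgn_in_def algebra_simps)
  qed
  also have "sum ?G (Pow I) = (\<Sum>S\<in>Pow I. F ((\<Sum>j\<in>I. sgn_in S j * v j) - v b))"
    using assms by (intro sum.cong refl) (auto simp: sgn_in_def)
  finally show ?thesis
    by (simp add: sum.distrib)
qed

lemma signs_second_moment:
  assumes "finite I"
  shows "(\<Sum>S\<in>Pow I. (\<Sum>j\<in>I. sgn_in S j * v j)\<^sup>2) = 2 ^ card I * (\<Sum>j\<in>I. (v j)\<^sup>2)"
  using assms
proof (induction I rule: finite_induct)
  case (insert b I)
  let ?s = "\<lambda>S. \<Sum>j\<in>I. sgn_in S j * v j"
  have sq: "(s + v b)\<^sup>2 + (s - v b)\<^sup>2 = 2 * s\<^sup>2 + 2 * (v b)\<^sup>2" for s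
    by (simp add: power2_eq_square algebra_simps)
  have "(\<Sum>S\<in>Pow (insert b I). (\<Sum>j\<in>insert b I. sgn_in S j * v j)\<^sup>2)
      = (\<Sum>S\<in>Pow I. 2 * (?s S)\<^sup>2 + 2 * (v b)\<^sup>2)"
    by (simp only: sum_Pow_insert_signs[OF insert.hyps, of "\<lambda>s. s\<^sup>2"] sq)
  also have "\<dots> = 2 * (\<Sum>S\<in>Pow I. (?s S)\<^sup>2) + 2 ^ card I * (2 * (v b)\<^sup>2)"
    using insert.hyps by (simp add: sum.distrib sum_distrib_left card_Pow)
  finally show ?case
    using insert by (simp add: algebra_simps)
qed simp

lemma signs_fourth_moment:
  assumes "finite I"
  shows "(\<Sum>S\<in>Pow I. (\<Sum>j\<in>I. sgn_in S j * v j) ^ 4) \<le> 2 ^ card I * (3 * (\<Sum>j\<in>I. (v j)\<^sup>2)\<^sup>2)"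
  using assms
proof (induction I rule: finite_induct)
  case (insert b I)
  let ?s = "\<lambda>S. \<Sum>j\<in>I. sgn_in S j * v j" and ?q = "\<Sum>j\<in>I. (v j)\<^sup>2"
  have sq: "(s + v b) ^ 4 + (s - v b) ^ 4 = 2 * s ^ 4 + 12 * (v b)\<^sup>2 * s\<^sup>2 + 2 * (v b) ^ 4" for s
    by (simp add: power2_eq_square power4_eq_xxxx algebra_simps)
  have "(\<Sum>S\<in>Pow (insert b I). (\<Sum>j\<in>insert b I. sgn_in S j * v j) ^ 4)
      = (\<Sum>S\<in>Pow I. 2 * ?s S ^ 4 + 12 * (v b)\<^sup>2 * (?s S)\<^sup>2 + 2 * (v b) ^ 4)"
    by (simp only: sum_Pow_insert_signs[OF insert.hyps, of "\<lambda>s. s ^ 4"] sq)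
  also have "\<dots> = 2 * (\<Sum>S\<in>Pow I. ?s S ^ 4) + 12 * (v b)\<^sup>2 * (\<Sum>S\<in>Pow I. (?s S)\<^sup>2)
        + 2 ^ card I * (2 * (v b) ^ 4)"
    using insert.hyps by (simp add: sum.distrib sum_distrib_left card_Pow)
  \<comment> \<open>Enlarging \<open>2 * (v b) ^ 4\<close> to \<open>6 * (v b) ^ 4\<close> completes
    the square: 6 q^2 + 12 v^2 q + 6 v^4 = 6 (q + v^2)^2.\<close>
  also have "\<dots> \<le> 2 * (2 ^ card I * (3 * ?q\<^sup>2)) + 12 * (v b)\<^sup>2 * (2 ^ card I * ?q)
        + 2 ^ card I * (6 * (v b) ^ 4)"
    using insert.IH insert.hyps by (intro add_mono mult_left_mono) (simp_all add: signs_second_moment)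
  also have "\<dots> = 2 ^ card (insert b I) * (3 * (\<Sum>j\<in>insert b I. (v j)\<^sup>2)\<^sup>2)"
    using insert.hyps by (simp add: power2_eq_square power4_eq_xxxx algebra_simps)
  finally show ?case .
qed simp

text \<open>The pointwise bound \<open>\<bar>x\<bar> \<ge> x\<^sup>2 - (4/27) x\<^sup>4\<close> reduces the first moment to the second and
  fourth ones.\<close>

lemma khintchine_first_moment:
  assumes "finite I"
  shows "2 ^ card I * L2_set v I \<le> 9 / 5 * (\<Sum>S\<in>Pow I. \<bar>\<Sum>j\<in>I. sgn_in S j * v j\<bar>)"
proof (cases "L2_set v I = 0")
  case True
  then show ?thesis
    by (simp add: sum_nonneg)
next
  case False
  define \<rho> where "\<rho> = L2_set v I"
  have \<rho>: "\<rho> > 0"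
    using False L2_set_nonneg[of v I] unfolding \<rho>_def by linarith
  have \<rho>2: "(\<Sum>j\<in>I. (v j)\<^sup>2) = \<rho>\<^sup>2"
    by (simp add: \<rho>_def L2_set_def sum_nonneg)
  \<comment> \<open>The pointwise bound in homogeneous form. The difference of the two sides has a
    double root at \<bar>s\<bar> = 3/2 \<rho>, hence the factorization.\<close>
  have ptw: "\<rho>\<^sup>2 * s\<^sup>2 - 4 / 27 * s ^ 4 \<le> \<rho> ^ 3 * \<bar>s\<bar>" for s
  proof -
    have "0 \<le> 4 / 27 * \<bar>s\<bar> * (\<bar>s\<bar> - 3 / 2 * \<rho>)\<^sup>2 * (\<bar>s\<bar> + 3 * \<rho>)"
      using \<rho> by (intro mult_nonneg_nonneg) auto
    also have "\<dots> = 4 / 27 * \<bar>s\<bar> ^ 4 - \<rho>\<^sup>2 * \<bar>s\<bar>\<^sup>2 + \<rho> ^ 3 * \<bar>s\<bar>"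
      by (simp add: power2_eq_square power3_eq_cube power4_eq_xxxx field_simps)
    finally show ?thesis
      by (simp add: power_even_abs)
  qed
  let ?s = "\<lambda>S. \<Sum>j\<in>I. sgn_in S j * v j"
  \<comment> \<open>The constant 9/5 comes from 1 - 3 * 4/27 = 5/9.\<close>
  have "2 ^ card I * (5 / 9 * \<rho> ^ 4)
      = \<rho>\<^sup>2 * (2 ^ card I * \<rho>\<^sup>2) - 4 / 27 * (2 ^ card I * (3 * (\<rho>\<^sup>2)\<^sup>2))"
    by (simp add: power2_eq_square power4_eq_xxxx algebra_simps)
  also have "\<dots> \<le> \<rho>\<^sup>2 * (\<Sum>S\<in>Pow I. (?s S)\<^sup>2) - 4 / 27 * (\<Sum>S\<in>Pow I. ?s S ^ 4)"
    using signs_second_moment[OF assms, of v] signs_fourth_moment[OF assms, of v]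
    unfolding \<rho>2 by (intro diff_mono mult_left_mono) auto
  also have "\<dots> = (\<Sum>S\<in>Pow I. \<rho>\<^sup>2 * (?s S)\<^sup>2 - 4 / 27 * ?s S ^ 4)"
    by (simp add: sum_subtractf sum_distrib_left)
  also have "\<dots> \<le> (\<Sum>S\<in>Pow I. \<rho> ^ 3 * \<bar>?s S\<bar>)"
    by (intro sum_mono ptw)
  also have "\<dots> = \<rho> ^ 3 * (\<Sum>S\<in>Pow I. \<bar>?s S\<bar>)"
    by (simp add: sum_distrib_left)
  finally have "\<rho> ^ 3 * (2 ^ card I * (5 / 9 * \<rho>)) \<le> \<rho> ^ 3 * (\<Sum>S\<in>Pow I. \<bar>?s S\<bar>)"
    by (simp add: power3_eq_cube power4_eq_xxxx mult_ac)
  then have "2 ^ card I * (5 / 9 * \<rho>) \<le> (\<Sum>S\<in>Pow I. \<bar>?s S\<bar>)"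
    using \<rho> by simp
  then show ?thesis
    by (simp add: \<rho>_def)
qed

section \<open>Partitions of unity in spaces of continuous functions\<close>

lemma apply_bcontfun_sum:
  fixes f :: "'i \<Rightarrow> ('t::topological_space \<Rightarrow>\<^sub>C 'b::real_normed_vector)"
  shows "apply_bcontfun (\<Sum>k\<in>T. f k) t = (\<Sum>k\<in>T. apply_bcontfun (f k) t)"
  by (induction T rule: infinite_finite_induct) auto

text \<open>The partition of unity is subordinate to balls on which every function in
  \<open>F\<close> differs from its value at the centre by less than \<eta>, so sampling at the
  centres suffices. The bound on signed sums makes the span of the \<phi> k a contractive image of a
  finite-dimensional sup-normed space; this is how the geometry of C[0,1] enters.\<close>

lemma partition_of_unity_approximation:
  fixes F :: "('t::metric_space \<Rightarrow>\<^sub>C real) set"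
  assumes K: "compact (UNIV :: 't set)" and F: "finite F" and \<eta>: "\<eta> > 0"
  obtains T :: "'t set" and \<phi> :: "'t \<Rightarrow> ('t \<Rightarrow>\<^sub>C real)"
  where "finite T"
    "\<And>e. (\<And>k. \<bar>e k\<bar> \<le> 1) \<Longrightarrow> norm (\<Sum>k\<in>T. e k *\<^sub>R \<phi> k) \<le> 1"
    "\<And>f. f \<in> F \<Longrightarrow> norm (f - (\<Sum>k\<in>T. apply_bcontfun f k *\<^sub>R \<phi> k)) \<le> \<eta>"
proof -
  have "\<forall>f :: 't \<Rightarrow>\<^sub>C real. \<exists>d>0. \<forall>s t. dist s t < d \<longrightarrow>
      dist (apply_bcontfun f s) (apply_bcontfun f t) < \<eta>"
    using compact_uniformly_continuous[OF continuous_on_apply_bcontfun K] \<eta>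
    unfolding uniformly_continuous_on_def by (metis UNIV_I dist_commute)
  then obtain d where "\<forall>f :: 't \<Rightarrow>\<^sub>C real. d f > 0 \<and> (\<forall>s t. dist s t < d f \<longrightarrow>
      dist (apply_bcontfun f s) (apply_bcontfun f t) < \<eta>)"
    by (rule choice[THEN exE]) blast
  then have d: "\<And>f. d f > 0"
    "\<And>f s t. dist s t < d f \<Longrightarrow> dist (apply_bcontfun f s) (apply_bcontfun f t) < \<eta>"
    by auto
  define r where "r = Min (insert 1 (d ` F))"
  have r: "r > 0" "\<And>f. f \<in> F \<Longrightarrow> r \<le> d f"
    unfolding r_def using F d(1) by auto
  obtain T :: "'t set" where T: "finite T" "UNIV \<subseteq> (\<Union>x\<in>T. ball x r)"
    using K r(1) unfolding compact_eq_totally_bounded by blast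
  \<comment> \<open>Tent functions at the centres, to be normalised by their positive sum
    \<open>\<Psi>\<close>.\<close>
  define \<psi> where "\<psi> k t = max 0 (r - dist k t)" for k t :: 't
  define \<Psi> where "\<Psi> t = (\<Sum>k\<in>T. \<psi> k t)" for t
  have \<psi>_nonneg: "\<psi> k t \<ge> 0" for k t
    by (simp add: \<psi>_def)
  have \<Psi>_pos: "\<Psi> t > 0" for t
  proof -
    obtain k where "k \<in> T" "dist k t < r"
      using T(2) by (auto simp: subset_iff)
    then show ?thesis
      unfolding \<Psi>_def using T(1) \<psi>_nonneg
      by (intro sum_pos2[of _ k]) (auto simp: \<psi>_def)
  qed
  have \<psi>_cont: "continuous_on UNIV (\<psi> k)" for k
    unfolding \<psi>_def by (intro continuous_intros)
  define \<phi> where "\<phi> k = Bcontfun (\<lambda>t. \<psi> k t / \<Psi> t)" for k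
  have "(\<lambda>t. \<psi> k t / \<Psi> t) \<in> bcontfun" if "k \<in> T" for k
  proof (rule bcontfun_normI)
    show "continuous_on UNIV (\<lambda>t. \<psi> k t / \<Psi> t)"
      unfolding \<Psi>_def using \<Psi>_pos
      by (intro continuous_intros \<psi>_cont) (auto simp: \<Psi>_def less_le)
    have "\<psi> k t \<le> \<Psi> t" for t
      unfolding \<Psi>_def using T(1) that \<psi>_nonneg by (intro member_le_sum) auto
    then show "norm (\<psi> k t / \<Psi> t) \<le> 1" for t
      using \<Psi>_pos[of t] \<psi>_nonneg[of k t] by simp
  qed
  then have \<phi>: "apply_bcontfun (\<phi> k) t = \<psi> k t / \<Psi> t" if "k \<in> T" for k t
    using that by (simp add: \<phi>_def Bcontfun_inverse)
  have apply_sum: "apply_bcontfun (\<Sum>k\<in>T. e k *\<^sub>R \<phi> k) t = (\<Sum>k\<in>T. e k * (\<psi> k t / \<Psi> t))" for e t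
    using T(1) by (simp add: apply_bcontfun_sum \<phi>)
  have sum1: "(\<Sum>k\<in>T. \<psi> k t / \<Psi> t) = 1" for t
    using \<Psi>_pos[of t] by (simp add: sum_divide_distrib[symmetric] \<Psi>_def)
  \<comment> \<open>A weighted average: only centres within distance r of t carry weight at
    t.\<close>
  have avg: "\<bar>\<Sum>k\<in>T. e k * (\<psi> k t / \<Psi> t)\<bar> \<le> c"
    if "\<And>k. k \<in> T \<Longrightarrow> \<psi> k t \<noteq> 0 \<Longrightarrow> \<bar>e k\<bar> \<le> c" for e t c
  proof -
    have "\<bar>\<Sum>k\<in>T. e k * (\<psi> k t / \<Psi> t)\<bar> \<le> (\<Sum>k\<in>T. \<bar>e k * (\<psi> k t / \<Psi> t)\<bar>)"
      by (rule sum_abs)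
    also have "\<dots> \<le> (\<Sum>k\<in>T. c * (\<psi> k t / \<Psi> t))"
    proof (rule sum_mono)
      fix k assume "k \<in> T"
      show "\<bar>e k * (\<psi> k t / \<Psi> t)\<bar> \<le> c * (\<psi> k t / \<Psi> t)"
      proof (cases "\<psi> k t = 0")
        case False
        then have "\<bar>e k\<bar> * (\<psi> k t / \<Psi> t) \<le> c * (\<psi> k t / \<Psi> t)"
          using that[OF \<open>k \<in> T\<close>] \<psi>_nonneg[of k t] \<Psi>_pos[of t] by (intro mult_right_mono) auto
        then show ?thesis
          using \<psi>_nonneg[of k t] \<Psi>_pos[of t] by (simp add: abs_mult)
      qed simp
    qed
    also have "\<dots> = c"
      by (simp only: sum_distrib_left[symmetric] sum1 mult_1_right)
    finally show ?thesis .
  qed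
  show thesis
  proof (rule that[OF T(1)])
    show "norm (\<Sum>k\<in>T. e k *\<^sub>R \<phi> k) \<le> 1" if "\<And>k. \<bar>e k\<bar> \<le> 1" for e :: "'t \<Rightarrow> real"
      by (intro norm_bound) (simp only: real_norm_def apply_sum avg that)
    show "norm (f - (\<Sum>k\<in>T. apply_bcontfun f k *\<^sub>R \<phi> k)) \<le> \<eta>" if "f \<in> F" for f
    proof (rule norm_bound)
      fix t
      have "apply_bcontfun (f - (\<Sum>k\<in>T. apply_bcontfun f k *\<^sub>R \<phi> k)) t
          = apply_bcontfun f t * (\<Sum>k\<in>T. \<psi> k t / \<Psi> t) - (\<Sum>k\<in>T. apply_bcontfun f k * (\<psi> k t / \<Psi> t))"
        by (simp only: minus_bcontfun.rep_eq apply_sum sum1 mult_1_right)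
      also have "\<dots> = (\<Sum>k\<in>T. (apply_bcontfun f t - apply_bcontfun f k) * (\<psi> k t / \<Psi> t))"
        by (simp only: sum_distrib_left sum_subtractf[symmetric] left_diff_distrib)
      also have "\<bar>\<dots>\<bar> \<le> \<eta>"
      proof (rule avg)
        fix k assume "k \<in> T" "\<psi> k t \<noteq> 0"
        then have "dist t k < d f"
          using r(2)[OF that] by (auto simp: \<psi>_def max_def dist_commute split: if_splits)
        then show "\<bar>apply_bcontfun f t - apply_bcontfun f k\<bar> \<le> \<eta>"
          using d(2)[of t k f] by (simp add: dist_real_def)
      qed
      finally show "norm (apply_bcontfun (f - (\<Sum>k\<in>T. apply_bcontfun f k *\<^sub>R \<phi> k)) t) \<le> \<eta>"
        by simp
    qed
  qed
qed

section \<open>The trace estimate for projections onto Hilbertian spans\<close>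

lemma span_image_finite_sum:
  assumes "x \<in> span (a ` I)" "finite I"
  shows "\<exists>c. x = (\<Sum>i\<in>I. c i *\<^sub>R a i)"
  using assms(1)
proof (rule span_induct_alt)
  show "\<exists>c. 0 = (\<Sum>i\<in>I. c i *\<^sub>R a i)"
    by (rule exI[of _ "\<lambda>_. 0"]) simp
  fix k z y
  assume "z \<in> a ` I" "\<exists>c. y = (\<Sum>i\<in>I. c i *\<^sub>R a i)"
  then obtain j c where j: "j \<in> I" "z = a j" and c: "y = (\<Sum>i\<in>I. c i *\<^sub>R a i)"
    by auto
  have "(\<Sum>i\<in>I. (if i = j then k else 0) *\<^sub>R a i) = k *\<^sub>R z"
    using j assms(2) by (simp add: if_distrib[of "\<lambda>c. c *\<^sub>R _"] cong: if_cong)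
  then have "k *\<^sub>R z + y = (\<Sum>i\<in>I. ((if i = j then k else 0) + c i) *\<^sub>R a i)"
    by (simp add: c scaleR_add_left sum.distrib)
  then show "\<exists>c. k *\<^sub>R z + y = (\<Sum>i\<in>I. c i *\<^sub>R a i)"
    by (intro exI[of _ "\<lambda>i. (if i = j then k else 0) + c i"])
qed

text \<open>The trace of the projection is compared with the average of its norm over the sign vectors
  of the cube: each \<open>L2_set (\<lambda>j. c j (\<phi> k)) I\<close> is, by Khintchine, an average of
  \<open>\<bar>\<Sum>j. \<plusminus> c j (\<phi> k)\<bar>\<close>, and the signs of these numbers can be absorbed in the \<open>\<phi> k\<close>.\<close>

lemma projection_constant_l2_lower_bound:
  fixes a :: "'i \<Rightarrow> ('t::metric_space \<Rightarrow>\<^sub>C real)"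
  assumes K: "compact (UNIV :: 't set)" and I: "finite I"
    and p: "linear p" "L \<ge> 0" "\<And>x. norm (p x) \<le> L * norm x" "range p \<subseteq> span (a ` I)"
      "\<And>i. i \<in> I \<Longrightarrow> p (a i) = a i"
    and AB: "A > 0" "B > 0"
    and lower: "\<And>t. L2_set t I / A \<le> norm (\<Sum>i\<in>I. t i *\<^sub>R a i)"
    and upper: "\<And>t. norm (\<Sum>i\<in>I. t i *\<^sub>R a i) \<le> B * L2_set t I"
  shows "sqrt (card I) \<le> 18 / 5 * (A * B) * L"
proof -
  have "\<forall>x. \<exists>c. p x = (\<Sum>i\<in>I. c i *\<^sub>R a i)"
    using p(4) span_image_finite_sum[OF _ I] by blast
  then obtain c where c: "\<And>x. p x = (\<Sum>i\<in>I. c x i *\<^sub>R a i)"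
    by (rule choice[THEN exE]) blast
  \<comment> \<open>The lower l2 estimate makes the a i linearly independent, so the coefficients of
    \<open>p x\<close> are unique and therefore linear in x.\<close>
  have uniq: "s i = t i" if "(\<Sum>i\<in>I. s i *\<^sub>R a i) = (\<Sum>i\<in>I. t i *\<^sub>R a i)" "i \<in> I" for s t i
  proof -
    have "(\<Sum>i\<in>I. (s i - t i) *\<^sub>R a i) = 0"
      using that(1) by (simp add: scaleR_diff_left sum_subtractf)
    then have "L2_set (\<lambda>i. s i - t i) I / A \<le> 0"
      using lower[of "\<lambda>i. s i - t i"] by simp
    then have "L2_set (\<lambda>i. s i - t i) I = 0"
      using AB L2_set_nonneg[of "\<lambda>i. s i - t i" I] by (simp add: divide_le_0_iff)
    then show ?thesis
      using I that(2) by (simp add: L2_set_eq_0_iff)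
  qed
  have c_lin: "linear (\<lambda>x. c x i)" if "i \<in> I" for i
  proof (rule linearI)
    fix x y r
    have "(\<Sum>i\<in>I. c (x + y) i *\<^sub>R a i) = (\<Sum>i\<in>I. (c x i + c y i) *\<^sub>R a i)"
      unfolding scaleR_add_left sum.distrib c[symmetric] by (rule linear_add[OF p(1)])
    then show "c (x + y) i = c x i + c y i"
      by (rule uniq[OF _ that])
    have "(\<Sum>i\<in>I. c (r *\<^sub>R x) i *\<^sub>R a i) = (\<Sum>i\<in>I. (r * c x i) *\<^sub>R a i)"
      unfolding scaleR_scaleR[symmetric] scaleR_sum_right[symmetric] c[symmetric] by (rule linear_scale[OF p(1)])
    from uniq[OF this that] show "c (r *\<^sub>R x) i = r *\<^sub>R c x i"
      by simp
  qed
  have c_sum: "c (\<Sum>k\<in>T. e k *\<^sub>R \<phi> k) i = (\<Sum>k\<in>T. e k * c (\<phi> k) i)"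
    if "i \<in> I" for i e \<phi> and T :: "'t set"
    using linear_sum[OF c_lin[OF that], of "\<lambda>k. e k *\<^sub>R \<phi> k" T] linear_scale[OF c_lin[OF that]]
    by simp
  have c_bound: "L2_set (c x) I \<le> A * (L * norm x)" for x
    using order_trans[OF lower[of "c x"] p(3)[of x, unfolded c]] AB
    by (simp add: pos_divide_le_eq mult_ac)
  have c_a: "c (a j) j = 1" if "j \<in> I" for j
  proof -
    have "(\<Sum>i\<in>I. c (a j) i *\<^sub>R a i) = (\<Sum>i\<in>I. (if i = j then 1 else 0) *\<^sub>R a i)"
      using p(5)[OF that] that I
      by (simp add: c[symmetric] if_distrib[of "\<lambda>c. c *\<^sub>R _"] cong: if_cong)
    from uniq[OF this that] show ?thesis
      by simp
  qed
  \<comment> \<open>So small that sampling a j changes the diagonal coefficient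
    \<open>c (a j) j = 1\<close> by at most \<open>A * (L * \<eta>) \<le> 1 / 2\<close>.\<close>
  define \<eta> where "\<eta> = 1 / (2 * (A * L + 1))"
  have AL: "A * L \<ge> 0"
    using AB p(2) by simp
  then have \<eta>: "\<eta> > 0" "A * (L * \<eta>) \<le> 1 / 2"
    by (auto simp: \<eta>_def field_simps)
  obtain T :: "'t set" and \<phi> where T: "finite T"
    and \<phi>: "\<And>e. (\<And>k. \<bar>e k\<bar> \<le> 1) \<Longrightarrow> norm (\<Sum>k\<in>T. e k *\<^sub>R \<phi> k) \<le> 1"
    and approx: "\<And>f. f \<in> a ` I \<Longrightarrow> norm (f - (\<Sum>k\<in>T. apply_bcontfun f k *\<^sub>R \<phi> k)) \<le> \<eta>"
    using partition_of_unity_approximation[OF K, of "a ` I" \<eta>] I \<eta>(1) by blast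
  have diag: "1 / 2 \<le> (\<Sum>k\<in>T. apply_bcontfun (a j) k * c (\<phi> k) j)" if j: "j \<in> I" for j
  proof -
    let ?z = "a j - (\<Sum>k\<in>T. apply_bcontfun (a j) k *\<^sub>R \<phi> k)"
    have "1 - (\<Sum>k\<in>T. apply_bcontfun (a j) k * c (\<phi> k) j) = c ?z j"
      using linear_diff[OF c_lin[OF j]] c_sum[OF j] c_a[OF j] by simp
    also have "\<dots> \<le> L2_set (\<lambda>i. \<bar>c ?z i\<bar>) I"
      using member_le_L2_set[OF I j, of "\<lambda>i. \<bar>c ?z i\<bar>"] by linarith
    also have "\<dots> = L2_set (c ?z) I"
      by (simp add: L2_set_def)
    also have "\<dots> \<le> A * (L * norm ?z)"
      by (rule c_bound)
    also have "\<dots> \<le> A * (L * \<eta>)"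
      using approx[of "a j"] j AB p(2) by (intro mult_left_mono) auto
    finally show ?thesis
      using \<eta>(2) by linarith
  qed
  have "real (card I) / 2 = (\<Sum>j\<in>I. 1 / 2)"
    by simp
  also have "\<dots> \<le> (\<Sum>j\<in>I. \<Sum>k\<in>T. apply_bcontfun (a j) k * c (\<phi> k) j)"
    by (intro sum_mono diag)
  also have "\<dots> = (\<Sum>k\<in>T. \<Sum>j\<in>I. apply_bcontfun (a j) k * c (\<phi> k) j)"
    by (rule sum.swap)
  \<comment> \<open>For fixed k the inner sum is the value at k of the function with coefficients
    \<open>c (\<phi> k)\<close>, so the upper l2 estimate bounds it.\<close>
  also have "\<dots> \<le> (\<Sum>k\<in>T. B * L2_set (c (\<phi> k)) I)"
  proof (rule sum_mono)
    fix k
    have "(\<Sum>j\<in>I. apply_bcontfun (a j) k * c (\<phi> k) j)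
        = apply_bcontfun (\<Sum>j\<in>I. c (\<phi> k) j *\<^sub>R a j) k"
      by (simp add: apply_bcontfun_sum mult.commute)
    also have "\<dots> \<le> norm (\<Sum>j\<in>I. c (\<phi> k) j *\<^sub>R a j)"
      using norm_bounded[of "\<Sum>j\<in>I. c (\<phi> k) j *\<^sub>R a j" k] by simp
    also have "\<dots> \<le> B * L2_set (c (\<phi> k)) I"
      by (rule upper)
    finally show "(\<Sum>j\<in>I. apply_bcontfun (a j) k * c (\<phi> k) j) \<le> B * L2_set (c (\<phi> k)) I" .
  qed
  finally have trace: "real (card I) / 2 \<le> B * (\<Sum>k\<in>T. L2_set (c (\<phi> k)) I)"
    by (simp add: sum_distrib_left)
  have signs: "(\<Sum>k\<in>T. \<bar>\<Sum>j\<in>I. sgn_in S j * c (\<phi> k) j\<bar>) \<le> sqrt (card I) * (A * L)" for S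
  proof -
    \<comment> \<open>The signs e k gather the absolute values into the coefficients of a single
      vector \<open>?w\<close> of norm at most 1. Cauchy-Schwarz against the sign vector, whose l2
      norm is \<open>sqrt (card I)\<close>, then applies.\<close>
    define e where "e k = sgn (\<Sum>j\<in>I. sgn_in S j * c (\<phi> k) j)" for k
    let ?w = "\<Sum>k\<in>T. e k *\<^sub>R \<phi> k"
    have w: "norm ?w \<le> 1"
      by (rule \<phi>) (simp add: e_def sgn_if)
    have "(\<Sum>k\<in>T. \<bar>\<Sum>j\<in>I. sgn_in S j * c (\<phi> k) j\<bar>)
        = (\<Sum>k\<in>T. \<Sum>j\<in>I. sgn_in S j * (e k * c (\<phi> k) j))"
      by (simp add: e_def abs_sgn sum_distrib_right mult_ac)
    also have "\<dots> = (\<Sum>j\<in>I. \<Sum>k\<in>T. sgn_in S j * (e k * c (\<phi> k) j))"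
      by (rule sum.swap)
    also have "\<dots> = (\<Sum>j\<in>I. sgn_in S j * c ?w j)"
      by (intro sum.cong refl) (simp add: c_sum sum_distrib_left)
    also have "\<dots> \<le> (\<Sum>j\<in>I. \<bar>sgn_in S j\<bar> * \<bar>c ?w j\<bar>)"
      by (intro sum_mono) (simp add: abs_mult[symmetric])
    also have "\<dots> \<le> L2_set (sgn_in S) I * L2_set (c ?w) I"
      by (rule L2_set_mult_ineq)
    also have "L2_set (sgn_in S) I = sqrt (card I)"
      by (simp add: L2_set_def sgn_in_def if_distrib[of "\<lambda>x. x\<^sup>2"] cong: if_cong)
    also have "sqrt (card I) * L2_set (c ?w) I \<le> sqrt (card I) * (A * L)"
    proof (intro mult_left_mono)
      have "L2_set (c ?w) I \<le> A * L * norm ?w"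
        using c_bound[of ?w] by (simp add: mult_ac)
      also have "\<dots> \<le> A * L"
        using w AL by (metis mult_left_mono mult_1_right)
      finally show "L2_set (c ?w) I \<le> A * L" .
    qed simp
    finally show ?thesis .
  qed
  have "2 ^ card I * (\<Sum>k\<in>T. L2_set (c (\<phi> k)) I)
      \<le> (\<Sum>k\<in>T. 9 / 5 * (\<Sum>S\<in>Pow I. \<bar>\<Sum>j\<in>I. sgn_in S j * c (\<phi> k) j\<bar>))"
    unfolding sum_distrib_left[of "2 ^ card I"] by (intro sum_mono khintchine_first_moment I)
  also have "\<dots> = 9 / 5 * (\<Sum>S\<in>Pow I. \<Sum>k\<in>T. \<bar>\<Sum>j\<in>I. sgn_in S j * c (\<phi> k) j\<bar>)"
    unfolding sum_distrib_left[of "9 / 5", symmetric] by (subst sum.swap) simp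
  also have "\<dots> \<le> 9 / 5 * (\<Sum>S\<in>Pow I. sqrt (card I) * (A * L))"
    by (intro mult_left_mono sum_mono signs) simp
  also have "\<dots> = 2 ^ card I * (9 / 5 * sqrt (card I) * (A * L))"
    using I by (simp add: card_Pow)
  finally have "(\<Sum>k\<in>T. L2_set (c (\<phi> k)) I) \<le> 9 / 5 * sqrt (card I) * (A * L)"
    by simp
  then have "B * (\<Sum>k\<in>T. L2_set (c (\<phi> k)) I) \<le> B * (9 / 5 * sqrt (card I) * (A * L))"
    using AB by (intro mult_left_mono) auto
  with trace have "real (card I) \<le> 2 * (B * (9 / 5 * sqrt (card I) * (A * L)))"
    by linarith
  \<comment> \<open>The factor 18/5 is twice 9/5. One \<open>sqrt (card I)\<close> cancels; for
    empty I the claim holds since its right-hand side is nonnegative.\<close>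
  then have "sqrt (card I) * sqrt (card I) \<le> sqrt (card I) * (18 / 5 * (A * B) * L)"
    by (simp add: mult_ac)
  moreover have "18 / 5 * (A * B) * L \<ge> 0"
    using AB p(2) by simp
  ultimately show ?thesis
    using mult_le_cancel_left_pos[of "sqrt (card I)"] real_sqrt_ge_zero[of "card I"]
    by (metis less_eq_real_def of_nat_0_le_iff)
qed

section \<open>From Lipschitz retractions to linear projections\<close>

text \<open>The Markov--Kakutani argument for the commuting maps \<open>g \<mapsto> (\<lambda>x. g (x + w) - g w)\<close>.
  The estimate is quantified over all base points \<open>z\<close> because only then is it inherited by the
  averages in the other directions.\<close>

lemma translation_additive_point:
  fixes G :: "('a::real_normed_vector \<Rightarrow> 'b::real_normed_vector) set" and H :: "'a set"
  assumes G: "compact G" "G \<noteq> {}"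
    and lip: "\<And>g x y. g \<in> G \<Longrightarrow> norm (g x - g y) \<le> L * norm (x - y)"
    and zero: "\<And>g. g \<in> G \<Longrightarrow> g 0 = 0"
    and H: "\<And>w k. w \<in> H \<Longrightarrow> real k *\<^sub>R w \<in> H"
    and trans: "\<And>g w. g \<in> G \<Longrightarrow> w \<in> H \<Longrightarrow> (\<lambda>x. g (x + w) - g w) \<in> G"
    and avg: "\<And>f k. (\<And>j. f j \<in> G) \<Longrightarrow> k > 0 \<Longrightarrow> (\<lambda>x. (1 / real k) *\<^sub>R (\<Sum>j<k. f j x)) \<in> G"
  obtains g where "g \<in> G" "\<And>x w. w \<in> H \<Longrightarrow> g (x + w) = g x + g w"
proof -
  \<comment> \<open>\<open>F (w, k)\<close> limits how much the increment of g by w depends on the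
    base point. Membership for all k removes the dependence, which together with
    \<open>g 0 = 0\<close> is additivity in direction w.\<close>
  define F where "F = (\<lambda>(w, k). {g :: 'a \<Rightarrow> 'b. \<forall>x z.
    norm ((g (x + z + w) - g (x + z)) - (g (z + w) - g z)) \<le> 2 * L * norm x / real (Suc k)})"
  have mem_F: "g \<in> F (w, k) \<longleftrightarrow> (\<forall>x z.
    norm ((g (x + z + w) - g (x + z)) - (g (z + w) - g z)) \<le> 2 * L * norm x / real (Suc k))" for g w k
    by (simp add: F_def)
  have closed_F: "closed (F p)" for p
  proof -
    have "continuous_on UNIV (\<lambda>g :: 'a \<Rightarrow> 'b. g x)" for x
      by simp
    then have "closed {g :: 'a \<Rightarrow> 'b. norm ((g (x + z + w) - g (x + z)) - (g (z + w) - g z)) \<le> c}"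
      for x z w c
      by (intro closed_Collect_le continuous_intros)
    then show ?thesis
      unfolding F_def by (auto split: prod.split simp: closed_Collect_all)
  qed
  \<comment> \<open>Averaging over the translates by 0, w, ..., k w telescopes the increment by w to
    one long difference divided by k + 1. Constraints already satisfied survive, being stable under
    translation and averaging.\<close>
  have step: "(\<lambda>x. (1 / real (Suc k)) *\<^sub>R (\<Sum>j<Suc k. g (x + real j *\<^sub>R w) - g (real j *\<^sub>R w)))
      \<in> G \<inter> F (w, k) \<inter> (\<Inter>p\<in>{p. g \<in> F p}. F p)" (is "?g \<in> _")
    if g: "g \<in> G" and w: "w \<in> H" for g w k
  proof (intro IntI INT_I)
    show "?g \<in> G"
      using avg[of "\<lambda>j x. g (x + real j *\<^sub>R w) - g (real j *\<^sub>R w)" "Suc k"] trans[OF g H[OF w]] by blast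
    let ?u = "real (Suc k) *\<^sub>R w"
    have tele: "?g (x + w) - ?g x = (1 / real (Suc k)) *\<^sub>R (g (x + ?u) - g x)" for x
    proof -
      have "(\<Sum>j<Suc k. g (x + w + real j *\<^sub>R w) - g (real j *\<^sub>R w))
          - (\<Sum>j<Suc k. g (x + real j *\<^sub>R w) - g (real j *\<^sub>R w))
          = (\<Sum>j<Suc k. g (x + real (Suc j) *\<^sub>R w) - g (x + real j *\<^sub>R w))"
        unfolding sum_subtractf[symmetric] by (intro sum.cong) (auto simp: algebra_simps)
      also have "\<dots> = g (x + ?u) - g x"
        by (subst sum_lessThan_telescope) simp
      finally show ?thesis
        by (simp only: scaleR_diff_right[symmetric])
    qed
    show "?g \<in> F (w, k)"
      unfolding mem_F
    proof (intro allI)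
      fix x z
      \<comment> \<open>The four terms are regrouped so that each difference spans x instead of the
        long step \<open>?u\<close>; the numerator is then bounded independently of k.\<close>
      have "(?g (x + z + w) - ?g (x + z)) - (?g (z + w) - ?g z)
          = (1 / real (Suc k)) *\<^sub>R ((g (x + z + ?u) - g (z + ?u)) - (g (x + z) - g z))"
        unfolding tele unfolding scaleR_diff_right[symmetric] by (simp add: algebra_simps)
      also have "norm \<dots> = norm ((g (x + z + ?u) - g (z + ?u)) - (g (x + z) - g z)) / real (Suc k)"
        by (simp del: of_nat_Suc)
      also have "\<dots> \<le> (2 * L * norm x) / real (Suc k)"
      proof (rule divide_right_mono)
        have "norm ((g (x + z + ?u) - g (z + ?u)) - (g (x + z) - g z))
            \<le> norm (g (x + z + ?u) - g (z + ?u)) + norm (g (x + z) - g z)"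
          by (rule norm_triangle_ineq4)
        also have "\<dots> \<le> L * norm (x + z + ?u - (z + ?u)) + L * norm (x + z - z)"
          by (intro add_mono lip g)
        finally show "norm ((g (x + z + ?u) - g (z + ?u)) - (g (x + z) - g z)) \<le> 2 * L * norm x"
          by (simp add: algebra_simps)
      qed simp
      finally show "norm ((?g (x + z + w) - ?g (x + z)) - (?g (z + w) - ?g z))
          \<le> 2 * L * norm x / real (Suc k)" .
    qed
    fix p assume "p \<in> {p. g \<in> F p}"
    then obtain v m where p: "p = (v, m)" and
      gF: "\<And>x z. norm ((g (x + z + v) - g (x + z)) - (g (z + v) - g z)) \<le> 2 * L * norm x / real (Suc m)"
      by (cases p) (auto simp: mem_F)
    have "norm ((?g (x + z + v) - ?g (x + z)) - (?g (z + v) - ?g z)) \<le> 2 * L * norm x / real (Suc m)"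
      for x z
    proof -
      \<comment> \<open>\<open>?d j\<close> is the defect of g in direction v at the base point
        \<open>z + real j *\<^sub>R w\<close>.\<close>
      let ?d = "\<lambda>j. (g (x + (z + real j *\<^sub>R w) + v) - g (x + (z + real j *\<^sub>R w)))
        - (g ((z + real j *\<^sub>R w) + v) - g (z + real j *\<^sub>R w))"
      let ?h = "\<lambda>y j. g (y + real j *\<^sub>R w) - g (real j *\<^sub>R w)"
      have "?d j = (?h (x + z + v) j - ?h (x + z) j) - (?h (z + v) j - ?h z j)" for j
        by (simp add: add_ac)
      then have "(\<Sum>j<Suc k. ?d j) = ((\<Sum>j<Suc k. ?h (x + z + v) j) - (\<Sum>j<Suc k. ?h (x + z) j))
          - ((\<Sum>j<Suc k. ?h (z + v) j) - (\<Sum>j<Suc k. ?h z j))"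
        by (simp only: sum_subtractf)
      then have "(?g (x + z + v) - ?g (x + z)) - (?g (z + v) - ?g z)
          = (1 / real (Suc k)) *\<^sub>R (\<Sum>j<Suc k. ?d j)"
        by (simp only: scaleR_diff_right)
      then have "norm ((?g (x + z + v) - ?g (x + z)) - (?g (z + v) - ?g z))
          = norm (\<Sum>j<Suc k. ?d j) / real (Suc k)"
        by (simp only: norm_scaleR) simp
      also have "\<dots> \<le> (\<Sum>j<Suc k. 2 * L * norm x / real (Suc m)) / real (Suc k)"
        using gF by (intro divide_right_mono sum_norm_le) simp_all
      also have "\<dots> = 2 * L * norm x / real (Suc m)"
        by (simp del: of_nat_Suc sum.lessThan_Suc)
      finally show ?thesis .
    qed
    then show "?g \<in> F p"
      unfolding p mem_F by blast
  qed
  \<comment> \<open>Finitely many constraints are met by adding them one at a time; compactness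
    meets all of them at once.\<close>
  have "G \<inter> (\<Inter>p\<in>H \<times> UNIV. F p) \<noteq> {}"
  proof (rule compact_imp_fip_image[OF G(1) closed_F])
    fix P assume "finite P" "P \<subseteq> H \<times> (UNIV :: nat set)"
    then show "G \<inter> (\<Inter>p\<in>P. F p) \<noteq> {}"
    proof (induction P rule: finite_induct)
      case empty
      then show ?case
        using G(2) by simp
    next
      case (insert p P)
      then obtain g where g: "g \<in> G" "\<And>q. q \<in> P \<Longrightarrow> g \<in> F q"
        by auto
      obtain w k where p: "p = (w, k)" "w \<in> H"
        using insert.prems by auto
      show ?case
        using step[OF g(1) p(2), of k] g(2) unfolding p(1) by blast
    qed
  qed
  then obtain g where g: "g \<in> G" "\<And>w k. w \<in> H \<Longrightarrow> g \<in> F (w, k)"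
    by blast
  have "g (x + w) = g x + g w" if w: "w \<in> H" for x w
  proof -
    define c where "c = norm (g (x + w) - g x - g w)"
    have "c \<le> 2 * L * norm x / real (Suc k)" for k
      using g(2)[OF w, of k, unfolded mem_F, rule_format, of x 0] zero[OF g(1)]
      by (simp add: c_def)
    moreover have "(\<lambda>k. 2 * L * norm x / real (Suc k)) \<longlonglongrightarrow> 0"
      by (intro tendsto_divide_0[OF tendsto_const] filterlim_at_top_imp_at_infinity
          filterlim_compose[OF filterlim_real_sequentially filterlim_Suc])
    ultimately have "c \<le> 0"
      by (intro LIMSEQ_le_const) auto
    then show ?thesis
      by (simp add: c_def algebra_simps)
  qed
  with g(1) that show thesis
    by blast
qed

text \<open>Two rounds of averaging. The first uses only translations by \<open>span B\<close>,
  since translating by another w need not preserve being the identity on \<open>span B\<close>. Once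
  g commutes with translations by \<open>span B\<close>, \<open>g (y + w) - g w = y\<close> holds
  there for every w, and the second round can use all translations.\<close>

lemma lipschitz_retraction_imp_linear_projection:
  fixes f :: "'a::real_normed_vector \<Rightarrow> 'a"
  assumes B: "finite B"
    and f: "\<And>x y. norm (f x - f y) \<le> L * norm (x - y)" "\<And>x. f x \<in> span B"
      "\<And>y. y \<in> span B \<Longrightarrow> f y = y"
  obtains p where "linear p" "\<And>x. norm (p x) \<le> L * norm x" "range p \<subseteq> span B"
    "\<And>y. y \<in> span B \<Longrightarrow> p y = y"
proof -
  define G where "G = {g. (\<forall>x y. norm (g x - g y) \<le> L * norm (x - y)) \<and> (\<forall>x. g x \<in> span B)
    \<and> (\<forall>y\<in>span B. g y = y)}"
  define G' where "G' = {g \<in> G. \<forall>x. \<forall>y\<in>span B. g (x + y) = g x + y}"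
  have coord: "continuous_on UNIV (\<lambda>g :: 'a \<Rightarrow> 'a. g x)" for x
    by simp
  have G0: "g 0 = 0" if "g \<in> G" for g
    using that span_zero[of B] unfolding G_def by blast
  have G_lip: "norm (g x - g y) \<le> L * norm (x - y)" if "g \<in> G" for g x y
    using that by (auto simp: G_def)
  have "closed {g :: 'a \<Rightarrow> 'a. norm (g x - g y) \<le> L * norm (x - y)}" for x y
    by (intro closed_Collect_le continuous_intros coord)
  moreover have "closed {g :: 'a \<Rightarrow> 'a. y \<in> span B \<longrightarrow> g y = y}" for y
    by (cases "y \<in> span B") (auto intro!: closed_Collect_eq continuous_intros)
  ultimately have "closed {g :: 'a \<Rightarrow> 'a. (\<forall>x y. norm (g x - g y) \<le> L * norm (x - y))
      \<and> (\<forall>y. y \<in> span B \<longrightarrow> g y = y)}" (is "closed ?C")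
    by (intro closed_Collect_conj closed_Collect_all)
  \<comment> \<open>The Lipschitz bound and \<open>g 0 = 0\<close> confine each g x to a compact
    ball of \<open>span B\<close>.\<close>
  moreover have "compact {g :: 'a \<Rightarrow> 'a. \<forall>x. g x \<in> span B \<inter> cball 0 (L * norm x)}"
    (is "compact ?D")
    by (intro compact_Pi_UNIV compact_span_Int_cball B)
  moreover have "G = ?C \<inter> ?D"
  proof (intro equalityI subsetI)
    fix g assume "g \<in> G"
    then show "g \<in> ?C \<inter> ?D"
      using G_lip[of g _ 0] G0[of g] by (auto simp: G_def)
  qed (auto simp: G_def)
  ultimately have G: "compact G"
    by (simp add: closed_Int_compact)
  have avg: "(\<lambda>x. (1 / real k) *\<^sub>R (\<Sum>j<k. h j x)) \<in> G"
    if h: "\<And>j. h j \<in> G" and k: "k > 0" for h k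
  proof -
    have "norm ((1 / real k) *\<^sub>R (\<Sum>j<k. h j x) - (1 / real k) *\<^sub>R (\<Sum>j<k. h j y)) \<le> L * norm (x - y)"
      for x y
    proof -
      have "norm ((1 / real k) *\<^sub>R (\<Sum>j<k. h j x) - (1 / real k) *\<^sub>R (\<Sum>j<k. h j y))
          = norm (\<Sum>j<k. h j x - h j y) / real k"
        by (simp add: scaleR_diff_right[symmetric] sum_subtractf)
      also have "\<dots> \<le> (\<Sum>j<k. L * norm (x - y)) / real k"
        by (intro divide_right_mono sum_norm_le G_lip h) simp
      also have "\<dots> = L * norm (x - y)"
        using k by simp
      finally show ?thesis .
    qed
    moreover have "(1 / real k) *\<^sub>R (\<Sum>j<k. h j x) \<in> span B" for x
      using h by (intro span_scale span_sum) (auto simp: G_def)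
    moreover have "(1 / real k) *\<^sub>R (\<Sum>j<k. h j y) = y" if "y \<in> span B" for y
    proof -
      have "h j y = y" for j
        using h[of j] that by (auto simp: G_def)
      then show ?thesis
        using k by (simp add: sum_constant_scaleR)
    qed
    ultimately show ?thesis
      by (simp add: G_def)
  qed
  obtain g where g: "g \<in> G" "\<And>x w. w \<in> span B \<Longrightarrow> g (x + w) = g x + g w"
  proof (rule translation_additive_point[of G L "span B"])
    show "G \<noteq> {}"
      unfolding G_def using f by blast
    show "(\<lambda>x. g (x + w) - g w) \<in> G" if "g \<in> G" "w \<in> span B" for g w
    proof -
      have "norm (g (x + w) - g w - (g (y + w) - g w)) \<le> L * norm (x - y)" for x y
        using G_lip[OF that(1), of "x + w" "y + w"] by simp
      then show ?thesis
        using that by (auto simp: G_def span_add span_diff)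
    qed
  qed (use G G_lip G0 avg span_scale in auto)
  have g': "g \<in> G'"
    using g by (auto simp: G'_def G_def)
  have "closed {g :: 'a \<Rightarrow> 'a. y \<in> span B \<longrightarrow> g (x + y) = g x + y}" for x y
    by (cases "y \<in> span B") (auto intro!: closed_Collect_eq continuous_intros)
  then have "closed {g :: 'a \<Rightarrow> 'a. \<forall>x y. y \<in> span B \<longrightarrow> g (x + y) = g x + y}"
    by (intro closed_Collect_all)
  moreover have "G' = G \<inter> {g. \<forall>x y. y \<in> span B \<longrightarrow> g (x + y) = g x + y}"
    by (auto simp: G'_def)
  ultimately have G': "compact G'"
    using G by (simp add: compact_Int_closed)
  obtain p where p: "p \<in> G'" "\<And>x w. w \<in> UNIV \<Longrightarrow> p (x + w) = p x + p w"
  proof (rule translation_additive_point[of G' L UNIV])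
    show "G' \<noteq> {}"
      using g' by blast
    show "(\<lambda>x. g (x + w) - g w) \<in> G'" if "g \<in> G'" for g w
    proof -
      have gG: "g \<in> G" and g_add: "\<And>x y. y \<in> span B \<Longrightarrow> g (x + y) = g x + y"
        using that by (auto simp: G'_def)
      have "norm (g (x + w) - g w - (g (y + w) - g w)) \<le> L * norm (x - y)" for x y
        using G_lip[OF gG, of "x + w" "y + w"] by simp
      moreover have "g (y + w) - g w = y" if "y \<in> span B" for y
        using g_add[OF that, of w] by (simp add: add.commute)
      moreover have "g (x + y + w) - g w = g (x + w) - g w + y" if "y \<in> span B" for x y
        using g_add[OF that, of "x + w"] by (simp add: algebra_simps)
      ultimately show ?thesis
        using gG by (auto simp: G'_def G_def span_diff)
    qed
    show "(\<lambda>x. (1 / real k) *\<^sub>R (\<Sum>j<k. h j x)) \<in> G'" if h: "\<And>j. h j \<in> G'" and k: "k > 0" for h k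
    proof -
      have "(1 / real k) *\<^sub>R (\<Sum>j<k. h j (x + y)) = (1 / real k) *\<^sub>R (\<Sum>j<k. h j x) + y"
        if "y \<in> span B" for x y
      proof -
        have "h j (x + y) = h j x + y" for j
          using h[of j] that by (auto simp: G'_def)
        then show ?thesis
          using k by (simp add: sum.distrib sum_constant_scaleR scaleR_add_right)
      qed
      moreover have "(\<lambda>x. (1 / real k) *\<^sub>R (\<Sum>j<k. h j x)) \<in> G"
        using h k by (intro avg) (auto simp: G'_def)
      ultimately show ?thesis
        by (simp add: G'_def)
    qed
  qed (use G' G_lip G0 in \<open>auto simp: G'_def\<close>)
  have pG: "p \<in> G"
    using p(1) by (simp add: G'_def)
  have bdd: "norm (p x) \<le> L * norm x" for x
    using G_lip[OF pG, of x 0] G0[OF pG] by simp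
  show thesis
  proof (rule that)
    show "linear p"
      using additive_bounded_imp_linear[of p L] p(2) bdd by simp
  qed (use bdd pG in \<open>auto simp: G_def\<close>)
qed

text \<open>Blowing f up by a factor c keeps its Lipschitz constant and makes it fix the ball of
  radius c in \<open>span B\<close>. A limit as c grows exists because all values lie in the
  finite-dimensional \<open>span W\<close>.\<close>

lemma lipschitz_retraction_of_approximate_ball_retractions:
  fixes W B :: "'a::real_normed_vector set"
  assumes W: "finite W" and B: "finite B"
    and approx: "\<And>\<delta>. \<delta> > 0 \<Longrightarrow> \<exists>f. (\<forall>x y. norm (f x - f y) \<le> L * norm (x - y)) \<and>
      (\<forall>x. f x \<in> span W \<and> (\<exists>y\<in>span B. dist (f x) y \<le> \<delta>)) \<and> (\<forall>y\<in>span B \<inter> cball 0 1. f y = y)"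
  obtains g where "\<And>x y. norm (g x - g y) \<le> L * norm (x - y)" "\<And>x. g x \<in> span B"
    "\<And>y. y \<in> span B \<Longrightarrow> g y = y"
proof -
  define F where "F k = {g :: 'a \<Rightarrow> 'a. (\<forall>x y. norm (g x - g y) \<le> L * norm (x - y)) \<and>
    (\<forall>x. infdist (g x) (span B) \<le> 1 / real (Suc k)) \<and>
    (\<forall>y. y \<in> span B \<inter> cball 0 (real (Suc k)) \<longrightarrow> g y = y)}" for k
  define S where "S = {g :: 'a \<Rightarrow> 'a. \<forall>x. g x \<in> span W \<inter> cball 0 (L * norm x)}"
  have coord: "continuous_on UNIV (\<lambda>g :: 'a \<Rightarrow> 'a. g x)" for x
    by simp
  have "closed {g :: 'a \<Rightarrow> 'a. y \<in> span B \<inter> cball 0 (real (Suc k)) \<longrightarrow> g y = y}" for y k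
    by (cases "y \<in> span B \<inter> cball 0 (real (Suc k))") (auto intro!: closed_Collect_eq continuous_intros)
  then have closed_F: "closed (F k)" for k
    unfolding F_def
    by (intro closed_Collect_conj closed_Collect_all closed_Collect_le continuous_intros coord
        continuous_on_infdist)
  have antimono: "F m \<subseteq> F k" if "k \<le> m" for k m
  proof -
    have "1 / real (Suc m) \<le> 1 / real (Suc k)" "real (Suc k) \<le> real (Suc m)"
      using that by (auto simp: frac_le)
    then show ?thesis
      unfolding F_def by (fastforce intro: order_trans)
  qed
  have ne: "S \<inter> F k \<noteq> {}" for k
  proof -
    define c where "c = real (Suc k)"
    have c: "c > 0"
      by (simp add: c_def)
    \<comment> \<open>The tolerance 1 / c^2 becomes 1 / c after the blow-up.\<close>
    obtain f where f: "\<And>x y. norm (f x - f y) \<le> L * norm (x - y)" "\<And>x. f x \<in> span W"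
      "\<And>x. \<exists>y\<in>span B. dist (f x) y \<le> 1 / c\<^sup>2" "\<And>y. y \<in> span B \<inter> cball 0 1 \<Longrightarrow> f y = y"
      using approx[of "1 / c\<^sup>2"] c by (metis zero_less_divide_1_iff zero_less_power)
    define g where "g x = c *\<^sub>R f ((1 / c) *\<^sub>R x)" for x
    have lip: "norm (g x - g y) \<le> L * norm (x - y)" for x y
    proof -
      have "norm (g x - g y) = c * norm (f ((1 / c) *\<^sub>R x) - f ((1 / c) *\<^sub>R y))"
        using c by (simp add: g_def scaleR_diff_right[symmetric])
      also have "\<dots> \<le> c * (L * norm ((1 / c) *\<^sub>R x - (1 / c) *\<^sub>R y))"
        using c by (intro mult_left_mono f) auto
      also have "\<dots> = L * norm (x - y)"
        using c by (simp add: scaleR_diff_right[symmetric])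
      finally show ?thesis .
    qed
    have fix_y: "g y = y" if "y \<in> span B \<inter> cball 0 c" for y
    proof -
      have "(1 / c) *\<^sub>R y \<in> span B \<inter> cball 0 1"
        using that c by (auto simp: span_scale field_simps)
      then show ?thesis
        using c by (simp add: g_def f(4))
    qed
    have g0: "g 0 = 0"
      using fix_y[of 0] c by (simp add: span_zero)
    have near: "infdist (g x) (span B) \<le> 1 / c" for x
    proof -
      obtain y where y: "y \<in> span B" "dist (f ((1 / c) *\<^sub>R x)) y \<le> 1 / c\<^sup>2"
        using f(3) by blast
      have "infdist (g x) (span B) \<le> dist (g x) (c *\<^sub>R y)"
        using y(1) by (intro infdist_le span_scale)
      also have "\<dots> = c * dist (f ((1 / c) *\<^sub>R x)) y"
        using c by (simp add: g_def dist_norm scaleR_diff_right[symmetric])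
      also have "\<dots> \<le> c * (1 / c\<^sup>2)"
        using c y(2) by (intro mult_left_mono) auto
      also have "\<dots> = 1 / c"
        using c by (simp add: power2_eq_square)
      finally show ?thesis .
    qed
    have "g x \<in> span W" for x
      unfolding g_def using f(2) by (rule span_scale)
    moreover have "norm (g x) \<le> L * norm x" for x
      using lip[of x 0] g0 by simp
    ultimately have "g \<in> S"
      by (auto simp: S_def)
    moreover have "g \<in> F k"
      using lip near fix_y by (simp add: F_def c_def)
    ultimately show ?thesis
      by blast
  qed
  \<comment> \<open>\<open>F k\<close> decreases with k, so finite intersections reduce to a single
    index.\<close>
  have "S \<inter> (\<Inter>k. F k) \<noteq> {}"
  proof (rule compact_imp_fip_image[OF _ closed_F])
    show "compact S"
      unfolding S_def by (intro compact_Pi_UNIV compact_span_Int_cball W)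
    fix J :: "nat set" assume "finite J"
    then have "F (Max (insert 0 J)) \<subseteq> (\<Inter>k\<in>J. F k)"
      by (intro INT_greatest antimono) auto
    then show "S \<inter> (\<Inter>k\<in>J. F k) \<noteq> {}"
      using ne[of "Max (insert 0 J)"] by blast
  qed
  then obtain g where g: "\<And>k. g \<in> F k"
    by blast
  show thesis
  proof (rule that)
    show "norm (g x - g y) \<le> L * norm (x - y)" for x y
      using g[of 0] by (simp add: F_def)
    show "g x \<in> span B" for x
    proof -
      have "infdist (g x) (span B) \<le> 1 / real (Suc k)" for k
        using g[of k] by (simp add: F_def)
      then have "infdist (g x) (span B) \<le> 0"
        by (intro LIMSEQ_le_const[OF LIMSEQ_inverse_real_of_nat]) (auto simp: inverse_eq_divide)
      then have "infdist (g x) (span B) = 0"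
        using infdist_nonneg[of "g x" "span B"] by linarith
      then show ?thesis
        using in_closed_iff_infdist_zero[OF closed_span_finite[OF B]] span_zero by blast
    qed
    show "g y = y" if "y \<in> span B" for y
    proof -
      obtain k where "norm y \<le> real k"
        using real_arch_simple by blast
      then have "y \<in> cball 0 (real (Suc k))"
        by simp
      then show ?thesis
        using g[of k] that by (auto simp: F_def)
    qed
  qed
qed

section \<open>Finite-dimensional decompositions\<close>

text \<open>Lets the results on Banach spaces below apply to C[0,1].\<close>

instance bcontfun :: (metric_space, banach) banach ..

definition fdd_coord :: "(nat \<Rightarrow> 'a::real_normed_vector set) \<Rightarrow> 'a \<Rightarrow> nat \<Rightarrow> 'a"
  where "fdd_coord Z x = (THE u. fdd_expansion Z x u)"

text \<open>General index sets cover both the natural projections P_n and the differences Q_n -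
  Q_(n-1).\<close>

definition fdd_block_proj :: "(nat \<Rightarrow> 'a::real_normed_vector set) \<Rightarrow> nat set \<Rightarrow> 'a \<Rightarrow> 'a"
  where "fdd_block_proj Z I x = (\<Sum>i\<in>I. fdd_coord Z x i)"

lemma fdd_proj_eq_block_proj: "fdd_proj Z n = fdd_block_proj Z {1..n}"
  by (simp add: fun_eq_iff fdd_proj_def fdd_block_proj_def fdd_coord_def)

context
  fixes Z :: "nat \<Rightarrow> 'a::banach set"
  assumes FDD: "is_FDD Z"
begin

lemma fdd_finite_span:
  assumes "n \<ge> 1"
  obtains B where "finite B" "Z n = span B"
  using FDD assms unfolding is_FDD_def by blast

lemma fdd_subspace: "n \<ge> 1 \<Longrightarrow> subspace (Z n)"
  by (metis fdd_finite_span subspace_span)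

lemma fdd_closed: "n \<ge> 1 \<Longrightarrow> closed (Z n)"
  by (metis fdd_finite_span closed_span_finite)

lemma fdd_expansion_coord: "fdd_expansion Z x (fdd_coord Z x)"
  unfolding fdd_coord_def using FDD unfolding is_FDD_def by (metis theI')

lemma fdd_coord_eqI: "fdd_expansion Z x u \<Longrightarrow> fdd_coord Z x = u"
  unfolding fdd_coord_def using FDD unfolding is_FDD_def by (metis the1_equality)

lemma fdd_coord_in: "i \<ge> 1 \<Longrightarrow> fdd_coord Z x i \<in> Z i"
  using fdd_expansion_coord[of x] by (simp add: fdd_expansion_def)

lemma fdd_coord_0: "fdd_coord Z x 0 = 0"
  using fdd_expansion_coord[of x] by (simp add: fdd_expansion_def)

text \<open>Sums and multiples of expansions are expansions, so uniqueness gives linearity.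
  Continuity is not yet available here.\<close>

lemma linear_fdd_coord: "linear (\<lambda>x. fdd_coord Z x i)"
proof (rule linearI)
  fix x y r
  have "fdd_expansion Z (x + y) (\<lambda>i. fdd_coord Z x i + fdd_coord Z y i)"
    using fdd_expansion_coord[of x] fdd_expansion_coord[of y]
    by (auto simp: fdd_expansion_def intro: sums_add subspace_add[OF fdd_subspace])
  from fdd_coord_eqI[OF this] show "fdd_coord Z (x + y) i = fdd_coord Z x i + fdd_coord Z y i"
    by simp
  have "fdd_expansion Z (r *\<^sub>R x) (\<lambda>i. r *\<^sub>R fdd_coord Z x i)"
    using fdd_expansion_coord[of x]
    by (auto simp: fdd_expansion_def intro: sums_scaleR_right subspace_scale[OF fdd_subspace])
  from fdd_coord_eqI[OF this] show "fdd_coord Z (r *\<^sub>R x) i = r *\<^sub>R fdd_coord Z x i"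
    by simp
qed

lemma linear_fdd_block_proj: "linear (fdd_block_proj Z I)"
  unfolding fdd_block_proj_def[abs_def] by (rule linear_compose_sum) (simp add: linear_fdd_coord)

lemma fdd_coord_block_proj:
  assumes "finite I" "0 \<notin> I"
  shows "fdd_coord Z (fdd_block_proj Z I x) i = (if i \<in> I then fdd_coord Z x i else 0)"
proof -
  have "fdd_expansion Z (fdd_block_proj Z I x) (\<lambda>i. if i \<in> I then fdd_coord Z x i else 0)"
    using assms sums_If_finite_set[OF assms(1), of "fdd_coord Z x"]
    by (auto simp: fdd_expansion_def fdd_block_proj_def fdd_coord_in subspace_0[OF fdd_subspace])
  from fdd_coord_eqI[OF this] show ?thesis
    by simp
qed

lemma fdd_block_proj_block_proj:
  assumes "finite I" "0 \<notin> I" "finite J"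
  shows "fdd_block_proj Z J (fdd_block_proj Z I x) = fdd_block_proj Z (I \<inter> J) x"
proof -
  have "fdd_block_proj Z J (fdd_block_proj Z I x) = (\<Sum>i\<in>J. if i \<in> I then fdd_coord Z x i else 0)"
    by (simp add: fdd_block_proj_def[of Z J] fdd_coord_block_proj[OF assms(1,2)])
  also have "\<dots> = fdd_block_proj Z (J \<inter> I) x"
    using assms(3) by (simp add: fdd_block_proj_def sum.inter_restrict)
  finally show ?thesis
    by (simp add: Int_commute)
qed

lemma range_fdd_block_proj_finite:
  assumes "finite I" "0 \<notin> I"
  obtains W where "finite W" "range (fdd_block_proj Z I) \<subseteq> span W"
proof -
  have "\<forall>i. \<exists>B. i \<ge> 1 \<longrightarrow> finite B \<and> Z i = span B"
    using FDD unfolding is_FDD_def by blast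
  then obtain B where B: "\<And>i. i \<ge> 1 \<Longrightarrow> finite (B i) \<and> Z i = span (B i)"
    by metis
  have I: "i \<ge> 1" if "i \<in> I" for i
    using that assms(2) by (cases i) auto
  have "fdd_coord Z x i \<in> span (\<Union>i\<in>I. B i)" if "i \<in> I" for x i
    using fdd_coord_in[OF I[OF that], of x] B[OF I[OF that]] that span_mono[of "B i" "\<Union>i\<in>I. B i"]
    by blast
  then have "range (fdd_block_proj Z I) \<subseteq> span (\<Union>i\<in>I. B i)"
    by (auto simp: fdd_block_proj_def intro: span_sum)
  moreover have "finite (\<Union>i\<in>I. B i)"
    using assms(1) B I by blast
  ultimately show thesis
    using that by blast
qed

lemma fdd_proj_tendsto: "(\<lambda>n. fdd_proj Z n x) \<longlonglongrightarrow> x"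
proof -
  have "fdd_coord Z x sums x"
    using fdd_expansion_coord[of x] by (simp add: fdd_expansion_def)
  then have "(\<lambda>n. \<Sum>i\<le>n. fdd_coord Z x i) \<longlonglongrightarrow> x"
    by (simp add: sums_def_le)
  moreover have "(\<Sum>i\<le>n. fdd_coord Z x i) = fdd_proj Z n x" for n
    unfolding fdd_proj_eq_block_proj fdd_block_proj_def
    by (rule sum.mono_neutral_right) (auto simp: fdd_coord_0 not_less_eq_eq Suc_le_eq)
  ultimately show ?thesis
    by simp
qed

lemma linear_fdd_proj: "linear (fdd_proj Z n)"
  unfolding fdd_proj_eq_block_proj by (rule linear_fdd_block_proj)

lemma fdd_coord_eq_proj_diff: "i \<ge> 1 \<Longrightarrow> fdd_coord Z x i = fdd_proj Z i x - fdd_proj Z (i - 1) x"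
  by (cases i) (simp_all add: fdd_proj_eq_block_proj fdd_block_proj_def)

section \<open>Uniform boundedness of the natural projections\<close>

text \<open>The Baire half of an open mapping argument. The sets \<open>A k\<close> cover the space
  because \<open>fdd_proj Z n x\<close> converges; as the projections are not yet known to be
  continuous, only the closure of some \<open>A k\<close> is seen to contain a ball. Hence y is
  merely approximated by z.\<close>

lemma fdd_approx_bounded:
  obtains C where "C \<ge> 0"
    "\<And>y \<eta>. \<eta> > 0 \<Longrightarrow> \<exists>z. norm (y - z) < \<eta> \<and> (\<forall>n. norm (fdd_proj Z n z) \<le> C * norm y)"
proof -
  define A where "A k = {x. \<forall>n. norm (fdd_proj Z n x) \<le> real k}" for k
  have "\<exists>k. interior (closure (A k)) \<noteq> {}"
  proof (rule ccontr)
    assume "\<nexists>k. interior (closure (A k)) \<noteq> {}"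
    then have "Met_TC.mtopology interior_of \<Union>(range (\<lambda>k. closure (A k))) = {}"
      by (intro Met_TC.metric_Baire_category_alt) (auto simp: complete_UNIV)
    moreover have "x \<in> (\<Union>k. closure (A k))" for x
    proof -
      have "bounded (range (\<lambda>n. fdd_proj Z n x))"
        using fdd_proj_tendsto by (rule convergent_imp_bounded)
      then obtain b where "\<And>n. norm (fdd_proj Z n x) \<le> b"
        by (auto simp: bounded_iff)
      moreover obtain k where "b \<le> real k"
        using real_arch_simple by blast
      ultimately have "x \<in> A k"
        unfolding A_def by (auto intro: order_trans)
      then show ?thesis
        using closure_subset by blast
    qed
    then have "(\<Union>k. closure (A k)) = UNIV"
      by blast
    ultimately show False
      by simp
  qed
  then obtain k x0 e where e: "e > 0" "ball x0 e \<subseteq> closure (A k)"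
    by (auto simp: mem_interior)
  \<comment> \<open>y is the difference of \<open>x0 + y\<close> and \<open>x0\<close>, both in the
    closure; this costs the factor 2.\<close>
  have small: "\<exists>z. norm (y - z) < \<eta> \<and> (\<forall>n. norm (fdd_proj Z n z) \<le> 2 * real k)"
    if y: "norm y < e" and \<eta>: "\<eta> > 0" for y \<eta>
  proof -
    have "x0 + y \<in> closure (A k)" "x0 \<in> closure (A k)"
      using e y by (auto simp: subset_iff dist_norm)
    then obtain u v where u: "u \<in> A k" "dist u (x0 + y) < \<eta> / 2" and v: "v \<in> A k" "dist v x0 < \<eta> / 2"
      using \<eta> by (meson closure_approachable half_gt_zero)
    have "norm (y - (u - v)) = norm ((v - x0) - (u - (x0 + y)))"
      by (simp add: algebra_simps)
    also have "\<dots> \<le> norm (v - x0) + norm (u - (x0 + y))"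
      by (rule norm_triangle_ineq4)
    also have "\<dots> < \<eta>"
      using u v by (simp add: dist_norm)
    finally have "norm (y - (u - v)) < \<eta>" .
    moreover have "norm (fdd_proj Z n (u - v)) \<le> 2 * real k" for n
    proof -
      have "norm (fdd_proj Z n (u - v)) \<le> norm (fdd_proj Z n u) + norm (fdd_proj Z n v)"
        unfolding linear_diff[OF linear_fdd_proj] by (rule norm_triangle_ineq4)
      also have "\<dots> \<le> real k + real k"
        using u(1) v(1) by (intro add_mono) (auto simp: A_def)
      finally show ?thesis
        by simp
    qed
    ultimately show ?thesis
      by blast
  qed
  show thesis
  proof (rule that)
    show "4 * real k / e \<ge> 0"
      using e by simp
    show "\<exists>z. norm (y - z) < \<eta> \<and> (\<forall>n. norm (fdd_proj Z n z) \<le> 4 * real k / e * norm y)"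
      if \<eta>: "\<eta> > 0" for y \<eta>
    proof (cases "y = 0")
      case True
      then show ?thesis
        using \<eta> by (intro exI[of _ 0]) (simp add: linear_0[OF linear_fdd_proj])
    next
      case False
      \<comment> \<open>s brings y to norm e / 2, inside the ball; undoing the scaling turns 2 k
        into 4 k / e times \<open>norm y\<close>.\<close>
      define s where "s = e / (2 * norm y)"
      have s: "s > 0"
        using False e by (simp add: s_def)
      have "norm (s *\<^sub>R y) < e"
        using False e by (simp add: s_def)
      then obtain z where z: "norm (s *\<^sub>R y - z) < s * \<eta>" "\<And>n. norm (fdd_proj Z n z) \<le> 2 * real k"
        using small[of "s *\<^sub>R y" "s * \<eta>"] s \<eta> by auto
      have "norm (y - (1 / s) *\<^sub>R z) = norm (s *\<^sub>R y - z) / s"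
      proof -
        have "y - (1 / s) *\<^sub>R z = (1 / s) *\<^sub>R (s *\<^sub>R y - z)"
          using s by (simp add: algebra_simps)
        then show ?thesis
          using s by simp
      qed
      also have "\<dots> < \<eta>"
        using z(1) s by (simp add: pos_divide_less_eq mult.commute)
      finally have "norm (y - (1 / s) *\<^sub>R z) < \<eta>" .
      moreover have "norm (fdd_proj Z n ((1 / s) *\<^sub>R z)) \<le> 4 * real k / e * norm y" for n
      proof -
        have "norm (fdd_proj Z n ((1 / s) *\<^sub>R z)) = norm (fdd_proj Z n z) / s"
          using s by (simp add: linear_scale[OF linear_fdd_proj])
        also have "\<dots> \<le> 2 * real k / s"
          using z(2) s by (simp add: divide_right_mono)
        also have "\<dots> = 4 * real k / e * norm y"
          using False e by (simp add: s_def field_simps)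
        finally show ?thesis .
      qed
      ultimately show ?thesis
        by blast
    qed
  qed
qed

text \<open>Successive approximation writes x as a series of vectors z j whose projections are
  bounded by a geometric sequence. The sums \<open>y m\<close> of their m-th projections are at most
  \<open>2 * C * norm x\<close>, and uniqueness of the expansion identifies \<open>y m\<close> with
  \<open>fdd_proj Z m x\<close>.\<close>

lemma fdd_proj_uniformly_bounded:
  obtains M where "M \<ge> 0" "\<And>n x. norm (fdd_proj Z n x) \<le> M * norm x"
proof -
  obtain C where C: "C \<ge> 0"
    "\<And>y \<eta>. \<eta> > 0 \<Longrightarrow> \<exists>z. norm (y - z) < \<eta> \<and> (\<forall>n. norm (fdd_proj Z n z) \<le> C * norm y)"
    using fdd_approx_bounded by blast
  define \<zeta> where "\<zeta> y \<eta> = (SOME z. norm (y - z) < \<eta> \<and> (\<forall>n. norm (fdd_proj Z n z) \<le> C * norm y))"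
    for y \<eta>
  have \<zeta>: "norm (y - \<zeta> y \<eta>) < \<eta>" "norm (fdd_proj Z n (\<zeta> y \<eta>)) \<le> C * norm y" if "\<eta> > 0" for y \<eta> n
    using someI_ex[OF C(2)[OF that, of y]] unfolding \<zeta>_def by auto
  have "norm (fdd_proj Z n x) \<le> (2 * C) * norm x" for n x
  proof (cases "x = 0")
    case True
    then show ?thesis
      by (simp add: linear_0[OF linear_fdd_proj])
  next
    case False
    \<comment> \<open>Halving tolerances make the remainders r j decay geometrically.\<close>
    define \<eta> where "\<eta> j = norm x * (1 / 2) ^ Suc j" for j
    have \<eta>: "\<eta> j > 0" for j
      using False by (simp add: \<eta>_def)
    define r where "r = rec_nat x (\<lambda>j y. y - \<zeta> y (\<eta> j))"
    define z where "z j = \<zeta> (r j) (\<eta> j)" for j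
    have r: "r 0 = x" "\<And>j. r (Suc j) = r j - z j"
      by (simp_all add: r_def z_def)
    have r_bound: "norm (r j) \<le> norm x * (1 / 2) ^ j" for j
    proof (cases j)
      case 0
      then show ?thesis
        by (simp add: r)
    next
      case (Suc i)
      then show ?thesis
        using \<zeta>(1)[OF \<eta>, of "r i" i] by (simp add: r z_def \<eta>_def)
    qed
    have z_bound: "norm (fdd_proj Z m (z j)) \<le> C * norm x * (1 / 2) ^ j" for m j
    proof -
      have "norm (fdd_proj Z m (z j)) \<le> C * norm (r j)"
        unfolding z_def by (rule \<zeta>(2)[OF \<eta>])
      also have "\<dots> \<le> C * (norm x * (1 / 2) ^ j)"
        by (intro mult_left_mono r_bound C)
      finally show ?thesis
        by simp
    qed
    have partial: "(\<Sum>j<J. z j) = x - r J" for J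
      by (induction J) (simp_all add: r)
    have "r \<longlonglongrightarrow> 0"
    proof (rule Lim_null_comparison[OF always_eventually])
      show "\<forall>j. norm (r j) \<le> norm x * (1 / 2) ^ j"
        using r_bound by blast
      show "(\<lambda>j. norm x * (1 / 2) ^ j) \<longlonglongrightarrow> 0"
        by (intro tendsto_mult_right_zero LIMSEQ_power_zero) simp
    qed
    then have sum_z: "(\<lambda>J. \<Sum>j<J. z j) \<longlonglongrightarrow> x"
      unfolding partial using tendsto_diff[OF tendsto_const, of r 0 sequentially x] by simp
    have geo: "summable (\<lambda>j. C * norm x * (1 / 2) ^ j :: real)"
      by (intro summable_mult summable_geometric) simp
    have summ: "summable (\<lambda>j. fdd_proj Z m (z j))" for m
      by (rule summable_comparison_test'[OF geo, of 0]) (rule z_bound)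
    define y where "y m = (\<Sum>j. fdd_proj Z m (z j))" for m
    have y_bound: "norm (y m) \<le> 2 * C * norm x" for m
    proof -
      have "norm (y m) \<le> (\<Sum>j. C * norm x * (1 / 2) ^ j)"
        unfolding y_def by (rule norm_suminf_le[OF z_bound geo])
      also have "\<dots> = C * norm x * (\<Sum>j. (1 / 2) ^ j)"
        by (intro suminf_mult summable_geometric) simp
      also have "\<dots> = 2 * C * norm x"
        by (simp add: suminf_geometric)
      finally show ?thesis .
    qed
    \<comment> \<open>The series defining \<open>y m\<close> converge uniformly in m, so the limits
      in m and in J may be interchanged.\<close>
    have y_lim: "y \<longlonglongrightarrow> x"
    proof (rule swap_uniform_limit'[where F = sequentially and S = UNIV
          and f = "\<lambda>J m. \<Sum>j<J. fdd_proj Z m (z j)" and g = "\<lambda>J. \<Sum>j<J. z j"])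
      show "\<forall>\<^sub>F J in sequentially. (\<lambda>m. \<Sum>j<J. fdd_proj Z m (z j)) \<longlonglongrightarrow> (\<Sum>j<J. z j)"
        by (intro always_eventually allI tendsto_sum fdd_proj_tendsto)
      show "uniform_limit UNIV (\<lambda>J m. \<Sum>j<J. fdd_proj Z m (z j)) y sequentially"
        unfolding y_def by (rule Weierstrass_m_test[OF z_bound geo])
    qed (use sum_z in auto)
    \<comment> \<open>The increments of y, with the dummy value 0 at index 0, are the candidate
      expansion of x. Each lies in Z i as a limit in a closed subspace.\<close>
    define w where "w i = (if i = 0 then 0 else y i - y (i - 1))" for i
    have "w i \<in> Z i" if "i \<ge> 1" for i
    proof -
      have "w i = (\<Sum>j. fdd_coord Z (z j) i)"
        using that by (simp add: w_def y_def fdd_coord_eq_proj_diff suminf_diff summ)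
      moreover have "summable (\<lambda>j. fdd_coord Z (z j) i)"
        using that by (simp add: fdd_coord_eq_proj_diff summable_diff summ)
      ultimately have "(\<lambda>J. \<Sum>j<J. fdd_coord Z (z j) i) \<longlonglongrightarrow> w i"
        by (simp add: summable_LIMSEQ)
      moreover have "(\<Sum>j<J. fdd_coord Z (z j) i) \<in> Z i" for J
        using that by (intro subspace_sum fdd_subspace fdd_coord_in)
      ultimately show ?thesis
        using closed_sequentially[OF fdd_closed[OF that], of "\<lambda>J. \<Sum>j<J. fdd_coord Z (z j) i"] by blast
    qed
    moreover have y0: "y 0 = 0"
      by (simp add: y_def fdd_proj_def)
    have w_sum: "(\<Sum>i\<le>m. w i) = y m" for m
      by (induction m) (simp_all add: w_def y0)
    ultimately have "fdd_expansion Z x w"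
      using y_lim by (simp add: fdd_expansion_def sums_def_le w_def)
    then have "fdd_coord Z x = w"
      by (rule fdd_coord_eqI)
    then have "fdd_proj Z n x = (\<Sum>i=1..n. w i)"
      by (simp add: fdd_proj_eq_block_proj fdd_block_proj_def)
    also have "\<dots> = (\<Sum>i\<le>n. w i)"
      by (rule sum.mono_neutral_left) (auto simp: w_def)
    finally show ?thesis
      using y_bound[of n] by (simp add: w_sum)
  qed
  with C(1) that[of "2 * C"] show thesis
    by simp
qed

end

section \<open>The blocks of the decomposition\<close>

lemma infdist_le_iff_compact:
  fixes S :: "'a::real_normed_vector set"
  assumes "compact S" "S \<noteq> {}"
  shows "infdist x S \<le> \<delta> \<longleftrightarrow> (\<exists>y\<in>S. dist x y \<le> \<delta>)"
proof
  assume le: "infdist x S \<le> \<delta>"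
  have "continuous_on S (dist x)"
    by (intro continuous_intros)
  then obtain y where y: "y \<in> S" "\<And>z. z \<in> S \<Longrightarrow> dist x y \<le> dist x z"
    using continuous_attains_inf[OF assms] by blast
  then have "dist x y \<le> infdist x S"
    using assms(2) by (auto simp: infdist_def intro!: cINF_greatest)
  with y(1) le show "\<exists>y\<in>S. dist x y \<le> \<delta>"
    by (intro bexI[of _ y]) auto
qed (meson infdist_le order_trans)

text \<open>Distances to a compact set are attained, so the neighbourhood is the Minkowski sum of S
  and a closed ball.\<close>

lemma convex_infdist_le:
  fixes S :: "'a::real_normed_vector set"
  assumes "compact S" "convex S" "S \<noteq> {}"
  shows "convex {x. infdist x S \<le> \<delta>}"
proof -
  have "{x. infdist x S \<le> \<delta>} = (\<Union>x\<in>S. \<Union>y\<in>cball 0 \<delta>. {x + y})"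
  proof (intro equalityI subsetI)
    fix x assume "x \<in> {x. infdist x S \<le> \<delta>}"
    then obtain y where "y \<in> S" "dist x y \<le> \<delta>"
      using infdist_le_iff_compact[OF assms(1,3)] by auto
    then have "x = y + (x - y)" "y \<in> S" "x - y \<in> cball 0 \<delta>"
      by (auto simp: dist_norm norm_minus_commute)
    then show "x \<in> (\<Union>x\<in>S. \<Union>y\<in>cball 0 \<delta>. {x + y})"
      by blast
  next
    fix x assume "x \<in> (\<Union>x\<in>S. \<Union>y\<in>cball 0 \<delta>. {x + y})"
    then obtain y v where "y \<in> S" "x = y + v" "norm v \<le> \<delta>"
      by auto
    then have "\<exists>y\<in>S. dist x y \<le> \<delta>"
      by (intro bexI[of _ y]) (auto simp: dist_norm)
    then show "x \<in> {x. infdist x S \<le> \<delta>}"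
      using infdist_le_iff_compact[OF assms(1,3)] by simp
  qed
  then show ?thesis
    using convex_sums[OF assms(2) convex_cball] by simp
qed

text \<open>These indices describe both spaces: X_n is the range of their block projection and Y_n
  the span of the corresponding a i.\<close>

definition sigma_block :: "nat \<Rightarrow> nat set"
  where "sigma_block n = {sigma (n - 1) + 1..sigma n}"

lemma sigma_mono: "m \<le> n \<Longrightarrow> sigma m \<le> sigma n"
  by (induction n) (auto simp: le_Suc_eq)

lemma finite_sigma_block: "finite (sigma_block n)"
  by (simp add: sigma_block_def)

lemma zero_notin_sigma_block: "0 \<notin> sigma_block n"
  by (simp add: sigma_block_def)

lemma card_sigma_block: "card (sigma_block n) = n"
  by (cases n) (simp_all add: sigma_block_def)

lemma sigma_block_disjoint:
  assumes "m \<noteq> n"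
  shows "sigma_block m \<inter> sigma_block n = {}"
proof -
  have "sigma_block m \<inter> sigma_block n = {}" if "m < n" for m n
  proof -
    have "sigma m \<le> sigma (n - 1)"
      using that by (intro sigma_mono) auto
    then show ?thesis
      by (auto simp: sigma_block_def)
  qed
  with assms show ?thesis
    by (metis Int_commute linorder_neqE_nat)
qed

lemma Y_block_eq: "Y_block a n = span (a ` sigma_block n)"
  by (simp add: Y_block_def sigma_block_def)

lemma fdd_proj_diff:
  assumes "m \<le> k"
  shows "fdd_proj Z k x - fdd_proj Z m x = fdd_block_proj Z {m + 1..k} x"
proof -
  have "{1..k} = {1..m} \<union> {m + 1..k}"
    using assms by auto
  then have "fdd_proj Z k x = fdd_proj Z m x + fdd_block_proj Z {m + 1..k} x"
    unfolding fdd_proj_eq_block_proj fdd_block_proj_def by (simp add: sum.union_disjoint)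
  then show ?thesis
    by simp
qed

lemma X_block_fdd_proj: "X_block (fdd_proj Z) n = range (fdd_block_proj Z (sigma_block n))"
proof -
  have "sigma (n - 1) \<le> sigma n"
    by (rule sigma_mono) simp
  then show ?thesis
    by (simp add: X_block_def Q_proj_def fdd_proj_diff sigma_block_def)
qed

context
  fixes Z :: "nat \<Rightarrow> 'a::banach set"
  assumes FDD: "is_FDD Z"
begin

text \<open>Independence of n matters: the Lipschitz constants stay bounded while sqrt n
  grows.\<close>

lemma fdd_block_proj_bounded:
  obtains M where "M \<ge> 0" "\<And>n x. norm (fdd_block_proj Z (sigma_block n) x) \<le> M * norm x"
proof -
  obtain M where M: "M \<ge> 0" "\<And>n x. norm (fdd_proj Z n x) \<le> M * norm x"
    using fdd_proj_uniformly_bounded[OF FDD] by blast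
  have "norm (fdd_block_proj Z (sigma_block n) x) \<le> (2 * M) * norm x" for n x
  proof -
    have "sigma (n - 1) \<le> sigma n"
      by (rule sigma_mono) simp
    then have "fdd_block_proj Z (sigma_block n) x = fdd_proj Z (sigma n) x - fdd_proj Z (sigma (n - 1)) x"
      by (simp add: fdd_proj_diff sigma_block_def)
    also have "norm \<dots> \<le> norm (fdd_proj Z (sigma n) x) + norm (fdd_proj Z (sigma (n - 1)) x)"
      by (rule norm_triangle_ineq4)
    also have "\<dots> \<le> M * norm x + M * norm x"
      by (intro add_mono M)
    finally show ?thesis
      by simp
  qed
  with M(1) that[of "2 * M"] show thesis
    by simp
qed

lemma bounded_linear_fdd_block_proj: "bounded_linear (fdd_block_proj Z (sigma_block n))"
proof -
  obtain M where "\<And>n x. norm (fdd_block_proj Z (sigma_block n) x) \<le> M * norm x"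
    using fdd_block_proj_bounded by blast
  then show ?thesis
    using linear_fdd_block_proj[OF FDD]
    by (intro bounded_linear.intro) (auto simp: linear_conv_bounded_linear bounded_linear_axioms_def mult.commute)
qed

lemma fdd_block_proj_X_block:
  assumes "x \<in> X_block (fdd_proj Z) m"
  shows "fdd_block_proj Z (sigma_block n) x = (if m = n then x else 0)"
proof -
  obtain y where x: "x = fdd_block_proj Z (sigma_block m) y"
    using assms by (auto simp: X_block_fdd_proj)
  show ?thesis
    unfolding x fdd_block_proj_block_proj[OF FDD finite_sigma_block zero_notin_sigma_block finite_sigma_block]
    by (cases "m = n") (auto simp: sigma_block_disjoint fdd_block_proj_def)
qed

lemma X_block_iff: "x \<in> X_block (fdd_proj Z) n \<longleftrightarrow> fdd_block_proj Z (sigma_block n) x = x"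
  using fdd_block_proj_X_block[of x n n] by (auto simp: X_block_fdd_proj intro: range_eqI[OF sym])

lemma subspace_X_block: "subspace (X_block (fdd_proj Z) n)"
  unfolding X_block_fdd_proj
  by (intro linear_subspace_image subspace_UNIV linear_fdd_block_proj FDD)

lemma closed_X_block: "closed (X_block (fdd_proj Z) n)"
proof -
  have "X_block (fdd_proj Z) n = {x. fdd_block_proj Z (sigma_block n) x = x}"
    using X_block_iff by blast
  then show ?thesis
    by (auto intro!: closed_Collect_eq linear_continuous_on bounded_linear_fdd_block_proj continuous_on_id)
qed

context
  fixes a :: "nat \<Rightarrow> 'a"
  assumes a_in: "\<forall>n\<ge>1. a n \<in> range (\<lambda>x. fdd_proj Z n x - fdd_proj Z (n - 1) x)"
begin

lemma Y_block_subset_X_block: "Y_block a n \<subseteq> X_block (fdd_proj Z) n"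
proof -
  have "a i \<in> X_block (fdd_proj Z) n" if i: "i \<in> sigma_block n" for i
  proof -
    have i1: "i \<ge> 1"
      using i by (simp add: sigma_block_def)
    then obtain x where "a i = fdd_block_proj Z {i} x"
      using a_in fdd_proj_diff[of "i - 1" i Z] by auto
    moreover have "fdd_block_proj Z (sigma_block n) (fdd_block_proj Z {i} x) = fdd_block_proj Z {i} x"
      using i i1 by (subst fdd_block_proj_block_proj[OF FDD]) (auto simp: finite_sigma_block)
    ultimately show ?thesis
      by (simp add: X_block_iff)
  qed
  then show ?thesis
    unfolding Y_block_eq by (intro span_minimal subspace_X_block) auto
qed

lemma compact_Y_ball: "compact (Y_block a n \<inter> cball 0 1)"
  unfolding Y_block_eq by (intro compact_span_Int_cball finite_imageI finite_sigma_block)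

lemma Y_ball_nonempty: "Y_block a n \<inter> cball 0 1 \<noteq> {}"
  using span_zero[of "a ` sigma_block n"] by (auto simp: Y_block_eq)

lemma B_nbhd_near:
  assumes "x \<in> B_nbhd (fdd_proj Z) a n \<delta>"
  obtains y where "y \<in> Y_block a n" "dist x y \<le> \<delta>"
  using assms infdist_le_iff_compact[OF compact_Y_ball Y_ball_nonempty] by (auto simp: B_nbhd_def)

lemma Y_ball_subset_B_nbhd: "\<delta> \<ge> 0 \<Longrightarrow> Y_block a n \<inter> cball 0 1 \<subseteq> B_nbhd (fdd_proj Z) a n \<delta>"
  using Y_block_subset_X_block by (auto simp: B_nbhd_def)

lemma zero_in_B_nbhd: "\<delta> \<ge> 0 \<Longrightarrow> 0 \<in> B_nbhd (fdd_proj Z) a n \<delta>"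
  using Y_ball_subset_B_nbhd[of \<delta> n] span_zero[of "a ` sigma_block n"] by (auto simp: Y_block_eq)

lemma convex_B_nbhd: "convex (B_nbhd (fdd_proj Z) a n \<delta>)"
proof -
  have "convex (Y_block a n \<inter> cball 0 1)"
    unfolding Y_block_eq by (intro convex_Int convex_cball subspace_imp_convex subspace_span)
  then have "convex {x. infdist x (Y_block a n \<inter> cball 0 1) \<le> \<delta>}"
    by (intro convex_infdist_le compact_Y_ball Y_ball_nonempty)
  moreover have "B_nbhd (fdd_proj Z) a n \<delta>
      = X_block (fdd_proj Z) n \<inter> {x. infdist x (Y_block a n \<inter> cball 0 1) \<le> \<delta>}"
    by (auto simp: B_nbhd_def)
  ultimately show ?thesis
    by (simp add: convex_Int subspace_imp_convex subspace_X_block)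
qed

lemma closed_B_nbhd: "closed (B_nbhd (fdd_proj Z) a n \<delta>)"
proof -
  have "closed {x. infdist x (Y_block a n \<inter> cball 0 1) \<le> \<delta>}"
    by (intro closed_Collect_le continuous_on_infdist continuous_on_id continuous_on_const)
  moreover have "B_nbhd (fdd_proj Z) a n \<delta>
      = X_block (fdd_proj Z) n \<inter> {x. infdist x (Y_block a n \<inter> cball 0 1) \<le> \<delta>}"
    by (auto simp: B_nbhd_def)
  ultimately show ?thesis
    by (simp add: closed_Int closed_X_block)
qed

text \<open>The preimage of the scaled n-th set under its block projection is closed and convex. It
  contains every generator of the hull: those of block n are fixed, the others go to 0, which lies
  in the n-th set.\<close>

lemma fdd_block_proj_hull:
  assumes \<delta>: "\<delta> n > 0"
    and x: "x \<in> closure (convex hull (\<Union>n\<in>{1..}. (\<lambda>x. l n *\<^sub>R x) ` B_nbhd (fdd_proj Z) a n (\<delta> n)))"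
  shows "fdd_block_proj Z (sigma_block n) x \<in> (\<lambda>x. l n *\<^sub>R x) ` B_nbhd (fdd_proj Z) a n (\<delta> n)"
proof -
  let ?D = "fdd_block_proj Z (sigma_block n)"
  let ?B = "(\<lambda>x. l n *\<^sub>R x) ` B_nbhd (fdd_proj Z) a n (\<delta> n)"
  let ?U = "\<Union>n\<in>{1..}. (\<lambda>x. l n *\<^sub>R x) ` B_nbhd (fdd_proj Z) a n (\<delta> n)"
  have "convex (?D -` ?B)"
    by (intro convex_linear_vimage linear_fdd_block_proj FDD convex_scaling convex_B_nbhd)
  moreover have "closed (?D -` ?B)"
    by (intro closed_vimage closed_scaling closed_B_nbhd linear_continuous_on bounded_linear_fdd_block_proj)
  moreover have "?U \<subseteq> ?D -` ?B"
  proof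
    fix u assume "u \<in> ?U"
    then obtain m y where m: "m \<ge> 1" and y: "y \<in> B_nbhd (fdd_proj Z) a m (\<delta> m)" and u: "u = l m *\<^sub>R y"
      by auto
    have "?D u = l m *\<^sub>R (if m = n then y else 0)"
      using y unfolding u linear_scale[OF linear_fdd_block_proj[OF FDD]]
      by (simp add: B_nbhd_def fdd_block_proj_X_block)
    then show "u \<in> ?D -` ?B"
      using y zero_in_B_nbhd[of "\<delta> n" n] \<delta> by (cases "m = n") (auto intro: image_eqI[of _ _ 0])
  qed
  ultimately have "closure (convex hull ?U) \<subseteq> ?D -` ?B"
    by (intro closure_minimal hull_minimal)
  with x show ?thesis
    by auto
qed

end

end

section \<open>Nonexistence of good retractions\<close>

text \<open>Otherwise blow-up and averaging would produce a linear projection onto Y_n of norm at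
  most \<open>sqrt n / 8\<close>, against the trace estimate.\<close>

lemma no_lipschitz_retraction_onto_B_nbhd:
  fixes Z :: "nat \<Rightarrow> ('t::metric_space \<Rightarrow>\<^sub>C real) set"
  assumes K: "compact (UNIV :: 't set)" and FDD: "is_FDD Z"
    and a_in: "\<forall>n\<ge>1. a n \<in> range (\<lambda>x. fdd_proj Z n x - fdd_proj Z (n - 1) x)"
    and equiv: "equiv_l2_basis C a" "C \<le> 2" and n: "n \<ge> 1"
  shows "\<exists>\<delta>>0. \<delta> \<le> 1 / real n \<and> \<not> (\<exists>f. (\<forall>x y. norm (f x - f y) \<le> sqrt n / 8 * norm (x - y)) \<and>
    range f \<subseteq> B_nbhd (fdd_proj Z) a n \<delta> \<and> (\<forall>x\<in>B_nbhd (fdd_proj Z) a n \<delta>. f x = x))"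
proof (rule ccontr)
  assume contra: "\<not> ?thesis"
  let ?I = "sigma_block n"
  obtain W where W: "finite W" "range (fdd_block_proj Z ?I) \<subseteq> span W"
    using range_fdd_block_proj_finite[OF FDD finite_sigma_block zero_notin_sigma_block] by blast
  have fin: "finite (a ` ?I)"
    by (intro finite_imageI finite_sigma_block)
  have "\<exists>f. (\<forall>x y. norm (f x - f y) \<le> sqrt n / 8 * norm (x - y)) \<and>
      (\<forall>x. f x \<in> span W \<and> (\<exists>y\<in>span (a ` ?I). dist (f x) y \<le> \<delta>)) \<and>
      (\<forall>y\<in>span (a ` ?I) \<inter> cball 0 1. f y = y)" if \<delta>: "\<delta> > 0" for \<delta>
  proof -
    \<comment> \<open>The negated claim provides retractions only for tolerances up to 1 / n; larger
      tolerances are served by these.\<close>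
    define \<delta>' where "\<delta>' = min \<delta> (1 / real n)"
    have \<delta>': "\<delta>' > 0" "\<delta>' \<le> 1 / real n" "\<delta>' \<le> \<delta>"
      using \<delta> n by (auto simp: \<delta>'_def)
    then obtain f where f: "\<forall>x y. norm (f x - f y) \<le> sqrt n / 8 * norm (x - y)"
      "range f \<subseteq> B_nbhd (fdd_proj Z) a n \<delta>'" "\<forall>x\<in>B_nbhd (fdd_proj Z) a n \<delta>'. f x = x"
      using contra by blast
    have "f x \<in> span W \<and> (\<exists>y\<in>span (a ` ?I). dist (f x) y \<le> \<delta>)" for x
    proof -
      have fx: "f x \<in> B_nbhd (fdd_proj Z) a n \<delta>'"
        using f(2) by blast
      then have "f x \<in> X_block (fdd_proj Z) n"
        by (simp add: B_nbhd_def)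
      then have "f x \<in> span W"
        using W(2) by (auto simp: X_block_fdd_proj)
      moreover obtain y where "y \<in> Y_block a n" "dist (f x) y \<le> \<delta>'"
        using B_nbhd_near[OF FDD a_in fx] by blast
      ultimately show ?thesis
        using \<delta>'(3) by (auto simp: Y_block_eq intro: order_trans)
    qed
    moreover have "f y = y" if "y \<in> span (a ` ?I) \<inter> cball 0 1" for y
      using Y_ball_subset_B_nbhd[OF FDD a_in, of \<delta>' n] \<delta>'(1) that f(3) by (auto simp: Y_block_eq)
    ultimately show ?thesis
      using f(1) by blast
  qed
  then obtain g where g: "\<And>x y. norm (g x - g y) \<le> sqrt n / 8 * norm (x - y)"
    "\<And>x. g x \<in> span (a ` ?I)" "\<And>y. y \<in> span (a ` ?I) \<Longrightarrow> g y = y"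
    using lipschitz_retraction_of_approximate_ball_retractions[OF W(1) fin] by blast
  obtain p where p: "linear p" "\<And>x. norm (p x) \<le> sqrt n / 8 * norm x" "range p \<subseteq> span (a ` ?I)"
    "\<And>y. y \<in> span (a ` ?I) \<Longrightarrow> p y = y"
    using lipschitz_retraction_imp_linear_projection[OF fin g] by blast
  obtain A B where AB: "A > 0" "B > 0" "A * B \<le> C"
    and l2: "\<And>N t. L2_set t {1..N} / A \<le> norm (\<Sum>i=1..N. t i *\<^sub>R a i)"
      "\<And>N t. norm (\<Sum>i=1..N. t i *\<^sub>R a i) \<le> B * L2_set t {1..N}"
    using equiv(1) unfolding equiv_l2_basis_def by blast
  have sub: "?I \<subseteq> {1..sigma n}"
    by (auto simp: sigma_block_def)
  \<comment> \<open>Extension by zero, since \<open>equiv_l2_basis\<close> speaks of initial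
    segments of the indices.\<close>
  have ext: "L2_set t ?I = L2_set (\<lambda>i. if i \<in> ?I then t i else 0) {1..sigma n}"
    "(\<Sum>i\<in>?I. t i *\<^sub>R a i) = (\<Sum>i=1..sigma n. (if i \<in> ?I then t i else 0) *\<^sub>R a i)" for t
    using sub unfolding L2_set_def
    by (auto intro!: sum.mono_neutral_cong_left arg_cong[where f = sqrt])
  have "sqrt (card ?I) \<le> 18 / 5 * (A * B) * (sqrt n / 8)"
  proof (rule projection_constant_l2_lower_bound[OF K finite_sigma_block p(1)])
    show "p (a i) = a i" if "i \<in> ?I" for i
      using that by (intro p(4) span_base imageI)
    show "L2_set t ?I / A \<le> norm (\<Sum>i\<in>?I. t i *\<^sub>R a i)" for t
      unfolding ext by (rule l2)
    show "norm (\<Sum>i\<in>?I. t i *\<^sub>R a i) \<le> B * L2_set t ?I" for t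
      unfolding ext by (rule l2)
  qed (use p AB in auto)
  \<comment> \<open>Here \<open>A * B \<le> C \<le> 2\<close>, and 18/5 * 2 / 8 = 9/10 is below
    1.\<close>
  also have "\<dots> \<le> 18 / 5 * 2 * (sqrt n / 8)"
    using AB equiv(2) by (intro mult_right_mono mult_left_mono) auto
  finally have "sqrt n \<le> 18 / 5 * 2 * (sqrt n / 8)"
    by (simp add: card_sigma_block)
  moreover have "sqrt n > 0"
    using n by simp
  ultimately show False
    by linarith
qed

theorem theorem5p5:
  fixes \<epsilon> :: real
    and Z :: "nat \<Rightarrow> C01 set"
    and P :: "nat \<Rightarrow> C01 \<Rightarrow> C01"
    and a :: "nat \<Rightarrow> C01"
  assumes "0 < \<epsilon>" and "\<epsilon> < 1"
    and "is_FDD Z" and "P = fdd_proj Z"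
    and "equiv_l2_basis (1 + \<epsilon>) a"
    and "(SUP n\<in>{1..}. banach_mazur_dist (range (P n)) (linf (dim (range (P n))))) < \<infinity>"
    and "\<forall>n\<ge>1. a n \<in> range (\<lambda>x. P n x - P (n - 1) x)"
  shows "\<exists>\<delta> :: nat \<Rightarrow> real. (\<forall>n\<ge>1. \<delta> n > 0) \<and> \<delta> \<longlonglongrightarrow> 0 \<and>
    (\<forall>l :: nat \<Rightarrow> real. (\<forall>n\<ge>1. l n > 0) \<longrightarrow>
      \<not> lipschitz_retract
          (closure (convex hull (\<Union>n\<in>{1..}. (\<lambda>x. l n *\<^sub>R x) ` B_nbhd P a n (\<delta> n)))))"
proof -
  note FDD = \<open>is_FDD Z\<close> and P = \<open>P = fdd_proj Z\<close>
  have a_in: "\<forall>n\<ge>1. a n \<in> range (\<lambda>x. fdd_proj Z n x - fdd_proj Z (n - 1) x)"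
    using assms(7) unfolding P .
  have bound: "1 + \<epsilon> \<le> 2"
    using assms(2) by simp
  let ?retr = "\<lambda>n \<delta> f. (\<forall>x y. norm (f x - f y) \<le> sqrt (real n) / 8 * norm (x - y)) \<and>
    range f \<subseteq> B_nbhd P a n \<delta> \<and> (\<forall>x\<in>B_nbhd P a n \<delta>. f x = x)"
  \<comment> \<open>\<delta> n is fixed before the weights are given; index 0 is
    unconstrained.\<close>
  have "\<forall>n. \<exists>\<delta>. n \<ge> 1 \<longrightarrow> \<delta> > 0 \<and> \<delta> \<le> 1 / real n \<and> \<not> (\<exists>f. ?retr n \<delta> f)"
    using no_lipschitz_retraction_onto_B_nbhd[OF compact_UNIV_unit_interval FDD a_in assms(5) bound]
    unfolding P by blast
  then obtain \<delta> where \<delta>: "\<And>n. n \<ge> 1 \<Longrightarrow> \<delta> n > 0" "\<And>n. n \<ge> 1 \<Longrightarrow> \<delta> n \<le> 1 / real n"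
    and no_retr: "\<And>n f. n \<ge> 1 \<Longrightarrow> \<not> ?retr n (\<delta> n) f"
    by (rule choice[THEN exE]) blast
  have "\<delta> \<longlonglongrightarrow> 0"
  proof (rule tendsto_sandwich[OF _ _ tendsto_const lim_1_over_n])
    show "\<forall>\<^sub>F n in sequentially. 0 \<le> \<delta> n"
      using \<delta>(1) by (intro eventually_sequentiallyI[of 1]) (auto simp: less_eq_real_def)
    show "\<forall>\<^sub>F n in sequentially. \<delta> n \<le> 1 / real n"
      using \<delta>(2) by (intro eventually_sequentiallyI[of 1])
  qed
  moreover have "\<not> lipschitz_retract
      (closure (convex hull (\<Union>n\<in>{1..}. (\<lambda>x. l n *\<^sub>R x) ` B_nbhd P a n (\<delta> n))))" (is "\<not> lipschitz_retract ?K")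
    if l: "\<And>n. n \<ge> 1 \<Longrightarrow> l n > 0" for l
  proof
    assume "lipschitz_retract ?K"
    then obtain R L where R: "L-lipschitz_on UNIV R" "range R \<subseteq> ?K" "\<And>x. x \<in> ?K \<Longrightarrow> R x = x"
      unfolding lipschitz_retract_def by blast
    obtain M where M: "M \<ge> 0" "\<And>n x. norm (fdd_block_proj Z (sigma_block n) x) \<le> M * norm x"
      using fdd_block_proj_bounded[OF FDD] by blast
    \<comment> \<open>The retraction built below has Lipschitz constant at most \<open>M * L\<close>
      in every block, so one block with sqrt n at least 8 M L gives the contradiction. Taking
      \<open>Suc N\<close> excludes index 0.\<close>
    obtain N where N: "(8 * (M * L))\<^sup>2 \<le> real N"
      using real_arch_simple by blast
    define n where "n = Suc N"
    have n: "n \<ge> 1"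
      by (simp add: n_def)
    have "8 * (M * L) \<le> sqrt (real n)"
      using N by (intro real_le_rsqrt) (simp add: n_def)
    then have lip_le: "M * L \<le> sqrt (real n) / 8"
      by simp
    let ?D = "fdd_block_proj Z (sigma_block n)"
    \<comment> \<open>The scalings by \<open>l n\<close> and \<open>1 / l n\<close> cancel in the
      Lipschitz constant, so the weights may be arbitrary.\<close>
    define f where "f x = (1 / l n) *\<^sub>R ?D (R (l n *\<^sub>R x))" for x
    have ln: "l n > 0"
      using l n by blast
    have "?retr n (\<delta> n) f"
    proof (intro conjI allI ballI)
      fix x y
      have "norm (f x - f y) = norm (?D (R (l n *\<^sub>R x) - R (l n *\<^sub>R y))) / l n"
        using ln by (simp add: f_def scaleR_diff_right[symmetric] linear_diff[OF linear_fdd_block_proj[OF FDD]])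
      also have "\<dots> \<le> M * norm (R (l n *\<^sub>R x) - R (l n *\<^sub>R y)) / l n"
        using ln by (intro divide_right_mono M) simp
      also have "\<dots> \<le> M * (L * norm (l n *\<^sub>R x - l n *\<^sub>R y)) / l n"
        using ln M(1) by (intro divide_right_mono mult_left_mono lipschitz_on_normD[OF R(1)]) auto
      also have "\<dots> = M * L * norm (x - y)"
        using ln by (simp add: scaleR_diff_right[symmetric])
      also have "\<dots> \<le> sqrt (real n) / 8 * norm (x - y)"
        by (intro mult_right_mono lip_le) simp
      finally show "norm (f x - f y) \<le> sqrt (real n) / 8 * norm (x - y)" .
    next
      show "range f \<subseteq> B_nbhd P a n (\<delta> n)"
      proof clarify
        fix x
        have "R (l n *\<^sub>R x) \<in> ?K"
          using R(2) by blast
        then have "?D (R (l n *\<^sub>R x)) \<in> (\<lambda>x. l n *\<^sub>R x) ` B_nbhd P a n (\<delta> n)"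
          unfolding P by (rule fdd_block_proj_hull[where \<delta> = \<delta>, OF FDD a_in \<delta>(1)[OF n]])
        then show "f x \<in> B_nbhd P a n (\<delta> n)"
          using ln by (auto simp: f_def)
      qed
    next
      fix x assume x: "x \<in> B_nbhd P a n (\<delta> n)"
      have "l n *\<^sub>R x \<in> (\<Union>n\<in>{1..}. (\<lambda>x. l n *\<^sub>R x) ` B_nbhd P a n (\<delta> n))"
        using n x by blast
      then have "l n *\<^sub>R x \<in> ?K"
        by (rule subsetD[OF closure_subset, OF hull_inc])
      moreover have "?D x = x"
        using x fdd_block_proj_X_block[OF FDD, of x n n] by (simp add: P B_nbhd_def)
      ultimately show "f x = x"
        using ln by (simp add: f_def R(3) linear_scale[OF linear_fdd_block_proj[OF FDD]])
    qed
    with no_retr[OF n] show False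
      by blast
  qed
  ultimately show ?thesis
    using \<delta>(1) by blast
qed

end
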